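(* Let $K_1,\dots,K_m\subset\mathbb{R}^2$ be compact convex sets which are centrally symmetric (i.e. $K_i=-K_i$), and let $q\ge0$ be an integer. Then $\int_{\lambda_1K_1+\dots+\lambda_mK_m}|s|^{2q}\,ds$ is a polynomial in $\lambda_1,\dots,\lambda_m\ge0$ with nonnegative coefficients.
   Context: $\lambda_1K_1+\dots+\lambda_mK_m$ denotes the Minkowski sum; $|\cdot|$ the Euclidean norm; $ds$ planar Lebesgue measure. *)

theory Defs
  imports "HOL-Analysis.Analysis"
begin

definition minkowski_comb :: "nat \<Rightarrow> (nat \<Rightarrow> real) \<Rightarrow> (nat \<Rightarrow> 'a::real_vector set) \<Rightarrow> 'a set" where
  "minkowski_comb m lam K =
     {y. \<exists>x. (\<forall>i<m. x i \<in> K i) \<and> y = (\<Sum>i<m. lam i *\<^sub>R x i)}"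

end

theory Submission
  imports Defs
begin

text \<open>
  Up to a positive factor, $|s|^{2q}$ is the sum of the powers $\langle s, v_k\rangle^{2q}$ over
  $q+1$ equally spaced directions $v_k$ of a half circle, so after a rotation it suffices to
  integrate $y^{2q}$ over $L = \sum_i \lambda_i K_i$. Let $H$ be the largest $y$ on $L$, let
  $h(s)$ be the maximum of $x - s y$ on $L$ and $Y(s)$ the height of a point where it is attained.
  All three are linear in $\lambda$. The right end of the chord of $L$ at height $y$ is the limit,
  as $M \to \infty$, of the minimum of $h(s) + s y$ over $|s| \le M$, which equals
  $\frac12 (h(M) + h(-M)) - \frac12 \int_{-M}^M |y - Y(s)|\, ds$ because $h' = -Y$. Integrating
  this against $y^{2q}$ shows that $\int_L y^{2q}$ is the limit of
  \[ \frac{2}{2q+1} H^{2q+1} (h(M) + h(-M) - 2 M H)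
     + \frac{2}{(2q+1)(2q+2)} \int_{-M}^M (H^{2q+2} - Y(s)^{2q+2})\, ds . \]
  Central symmetry gives $|Y_i(s)| \le H_i$ and $2 M H_i \le h_i(M) + h_i(-M)$ for each $K_i$, so
  the coefficients are nonnegative, and they stay bounded as $M \to \infty$.
\<close>

subsection \<open>Homogeneous polynomials with nonnegative coefficients\<close>

lemma set_integrable_Icc_bounded:
  fixes f :: "real \<Rightarrow> real"
  assumes "f \<in> borel_measurable borel" "\<And>x. x \<in> {a..b} \<Longrightarrow> \<bar>f x\<bar> \<le> B"
  shows "set_integrable lborel {a..b} f"
  unfolding set_integrable_def
proof (rule integrableI_bounded_set[where B = B and A = "{a..b}"])
  show "(\<lambda>x. indicator {a..b} x *\<^sub>R f x) \<in> borel_measurable lborel"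
    using assms(1) by measurable
qed (use assms(2) in \<open>auto simp: indicator_def emeasure_lborel_Icc_eq\<close>)


text \<open>Monomials of degree \<open>n\<close> are indexed by words \<open>f\<close> of length \<open>n\<close> rather than by exponent
  vectors, so that a product of linear forms expands without multinomial coefficients.\<close>

definition homogeneous_nonneg :: "nat \<Rightarrow> nat \<Rightarrow> ((nat \<Rightarrow> real) \<Rightarrow> real) \<Rightarrow> bool" where
  "homogeneous_nonneg m n F \<longleftrightarrow>
     (\<exists>C. (\<forall>f \<in> {..<n} \<rightarrow>\<^sub>E {..<m}. 0 \<le> C f) \<and>
       (\<forall>lam. (\<forall>i<m. 0 \<le> lam i) \<longrightarrow>
          F lam = (\<Sum>f \<in> {..<n} \<rightarrow>\<^sub>E {..<m}. C f * (\<Prod>k<n. lam (f k)))))"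

lemma homogeneous_nonneg_cong:
  assumes "homogeneous_nonneg m n F"
    and "\<And>lam. (\<And>i. i < m \<Longrightarrow> 0 \<le> lam i) \<Longrightarrow> G lam = F lam"
  shows "homogeneous_nonneg m n G"
proof -
  have "G lam = F lam" if "\<forall>i<m. 0 \<le> lam i" for lam using assms(2) that by blast
  then show ?thesis using assms(1) unfolding homogeneous_nonneg_def by simp
qed

text \<open>Words with the same letter counts give the same monomial, so the coefficient of an
  exponent vector is the sum of the nonnegative coefficients of the words that it collects.\<close>

lemma homogeneous_nonneg_exponents:
  assumes "homogeneous_nonneg m n F"
  shows "\<exists>c :: (nat \<Rightarrow> nat) \<Rightarrow> real.
           finite {\<alpha>. c \<alpha> \<noteq> 0} \<and> (\<forall>\<alpha>. c \<alpha> \<ge> 0) \<and>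
           (\<forall>lam :: nat \<Rightarrow> real. (\<forall>i<m. lam i \<ge> 0) \<longrightarrow>
              F lam = (\<Sum>\<alpha>\<in>{\<alpha>. c \<alpha> \<noteq> 0}. c \<alpha> * (\<Prod>i<m. lam i ^ \<alpha> i)))"
proof -
  define P where "P = {..<n} \<rightarrow>\<^sub>E {..<m}"
  have fin: "finite P" unfolding P_def by (intro finite_PiE) auto
  obtain C where C0: "\<And>f. f \<in> P \<Longrightarrow> 0 \<le> C f"
    and C: "\<And>lam. (\<forall>i<m. 0 \<le> lam i) \<Longrightarrow> F lam = (\<Sum>f \<in> P. C f * (\<Prod>k<n. lam (f k)))"
    using assms unfolding homogeneous_nonneg_def P_def by blast
  define e where "e f i = card {k \<in> {..<n}. f k = i}" for f :: "nat \<Rightarrow> nat" and i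
  define c where "c \<alpha> = (\<Sum>f | f \<in> P \<and> e f = \<alpha>. C f)" for \<alpha>
  have sub: "{\<alpha>. c \<alpha> \<noteq> 0} \<subseteq> e ` P"
  proof
    fix \<alpha> assume "\<alpha> \<in> {\<alpha>. c \<alpha> \<noteq> 0}"
    then have "{f. f \<in> P \<and> e f = \<alpha>} \<noteq> {}" unfolding c_def by (metis (mono_tags, lifting) mem_Collect_eq sum.empty)
    then show "\<alpha> \<in> e ` P" by auto
  qed
  have mono: "(\<Prod>k<n. lam (f k)) = (\<Prod>i<m. lam i ^ e f i)" if "f \<in> P" for f and lam :: "nat \<Rightarrow> real"
  proof -
    have "(\<Prod>k<n. lam (f k)) = (\<Prod>i<m. \<Prod>k | k \<in> {..<n} \<and> f k = i. lam (f k))"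
      by (rule prod.group[symmetric]) (use that in \<open>auto simp: P_def\<close>)
    also have "\<dots> = (\<Prod>i<m. \<Prod>k | k \<in> {..<n} \<and> f k = i. lam i)"
      by (intro prod.cong) auto
    finally show ?thesis by (simp add: e_def)
  qed
  show ?thesis
  proof (intro exI[of _ c] conjI allI impI)
    show "finite {\<alpha>. c \<alpha> \<noteq> 0}" using sub fin by (meson finite_imageI finite_subset)
    show "0 \<le> c \<alpha>" for \<alpha> unfolding c_def by (intro sum_nonneg) (auto simp: C0)
    fix lam :: "nat \<Rightarrow> real" assume lam: "\<forall>i<m. 0 \<le> lam i"
    \<comment> \<open>Exponent vectors of words with total coefficient 0 are added back, so that the
      double sum over vectors and their words collapses to a sum over \<open>P\<close>.\<close>
    have "(\<Sum>\<alpha>\<in>{\<alpha>. c \<alpha> \<noteq> 0}. c \<alpha> * (\<Prod>i<m. lam i ^ \<alpha> i)) = (\<Sum>\<alpha>\<in>e ` P. c \<alpha> * (\<Prod>i<m. lam i ^ \<alpha> i))"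
      by (intro sum.mono_neutral_left sub) (use fin in auto)
    also have "\<dots> = (\<Sum>\<alpha>\<in>e ` P. \<Sum>f | f \<in> P \<and> e f = \<alpha>. C f * (\<Prod>i<m. lam i ^ e f i))"
      unfolding c_def by (auto simp: sum_distrib_right intro!: sum.cong)
    also have "\<dots> = (\<Sum>f\<in>P. C f * (\<Prod>i<m. lam i ^ e f i))"
      by (rule sum.image_gen[OF fin, symmetric])
    also have "\<dots> = F lam" using C[OF lam] mono by simp
    finally show "F lam = (\<Sum>\<alpha>\<in>{\<alpha>. c \<alpha> \<noteq> 0}. c \<alpha> * (\<Prod>i<m. lam i ^ \<alpha> i))" by simp
  qed
qed

lemma homogeneous_nonneg_0: "homogeneous_nonneg m n (\<lambda>lam. 0)"
  unfolding homogeneous_nonneg_def by (intro exI[of _ "\<lambda>_. 0"]) auto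

lemma homogeneous_nonneg_add:
  assumes "homogeneous_nonneg m n F" "homogeneous_nonneg m n G"
  shows "homogeneous_nonneg m n (\<lambda>lam. F lam + G lam)"
proof -
  obtain C D where "\<forall>f \<in> {..<n} \<rightarrow>\<^sub>E {..<m}. 0 \<le> C f" "\<forall>f \<in> {..<n} \<rightarrow>\<^sub>E {..<m}. 0 \<le> D f"
    "\<forall>lam. (\<forall>i<m. 0 \<le> lam i) \<longrightarrow> F lam = (\<Sum>f \<in> {..<n} \<rightarrow>\<^sub>E {..<m}. C f * (\<Prod>k<n. lam (f k)))"
    "\<forall>lam. (\<forall>i<m. 0 \<le> lam i) \<longrightarrow> G lam = (\<Sum>f \<in> {..<n} \<rightarrow>\<^sub>E {..<m}. D f * (\<Prod>k<n. lam (f k)))"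
    using assms unfolding homogeneous_nonneg_def by blast
  then show ?thesis unfolding homogeneous_nonneg_def
    by (intro exI[of _ "\<lambda>f. C f + D f"]) (simp add: distrib_right sum.distrib)
qed

lemma homogeneous_nonneg_cmult:
  assumes "homogeneous_nonneg m n F" "0 \<le> a"
  shows "homogeneous_nonneg m n (\<lambda>lam. a * F lam)"
proof -
  obtain C where "\<forall>f \<in> {..<n} \<rightarrow>\<^sub>E {..<m}. 0 \<le> C f"
    "\<forall>lam. (\<forall>i<m. 0 \<le> lam i) \<longrightarrow> F lam = (\<Sum>f \<in> {..<n} \<rightarrow>\<^sub>E {..<m}. C f * (\<Prod>k<n. lam (f k)))"
    using assms unfolding homogeneous_nonneg_def by blast
  then show ?thesis unfolding homogeneous_nonneg_def
    by (intro exI[of _ "\<lambda>f. a * C f"]) (simp add: sum_distrib_left mult.assoc \<open>0 \<le> a\<close>)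
qed

lemma homogeneous_nonneg_sum:
  assumes "\<And>j. j \<in> J \<Longrightarrow> homogeneous_nonneg m n (F j)"
  shows "homogeneous_nonneg m n (\<lambda>lam. \<Sum>j\<in>J. F j lam)"
  using assms
  by (induction J rule: infinite_finite_induct)
    (auto intro: homogeneous_nonneg_0 homogeneous_nonneg_add)

lemma prod_linear_forms:
  fixes a :: "nat \<Rightarrow> nat \<Rightarrow> real"
  shows "(\<Prod>k<n. \<Sum>i<m. lam i * a k i) =
    (\<Sum>f \<in> {..<n} \<rightarrow>\<^sub>E {..<m}. (\<Prod>k<n. a k (f k)) * (\<Prod>k<n. lam (f k)))"
  by (subst prod_sum_PiE) (auto simp: prod.distrib mult.commute)

text \<open>The linear forms may differ from factor to factor because the boundary term of the
  moment formula is a power of \<open>H\<close> times one different linear form.\<close>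

lemma homogeneous_nonneg_prod_linear:
  assumes "\<And>k i. k < n \<Longrightarrow> i < m \<Longrightarrow> 0 \<le> a k i"
  shows "homogeneous_nonneg m n (\<lambda>lam. \<Prod>k<n. \<Sum>i<m. lam i * a k i)"
  unfolding homogeneous_nonneg_def prod_linear_forms
  by (intro exI[of _ "\<lambda>f. \<Prod>k<n. a k (f k)"]) (auto intro!: prod_nonneg assms)

text \<open>Both powers expand over the same words. The coefficient of a word is the integral of a
  product of values \<open>H i\<close> minus the matching product of values \<open>Y i s\<close>,
  and \<open>le\<close> makes this integrand nonnegative for every \<open>s\<close>.\<close>

lemma homogeneous_nonneg_integral_power_diff:
  assumes Y: "\<And>i. i < m \<Longrightarrow> Y i \<in> borel_measurable borel"
    and le: "\<And>i s. i < m \<Longrightarrow> \<bar>Y i s\<bar> \<le> H i"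
  shows "homogeneous_nonneg m n (\<lambda>lam. LBINT s:{a..b::real}.
            (\<Sum>i<m. lam i * H i) ^ n - (\<Sum>i<m. lam i * Y i s) ^ n)"
proof -
  define P where "P = {..<n} \<rightarrow>\<^sub>E {..<m}"
  define G where "G f s = (\<Prod>k<n. H (f k)) - (\<Prod>k<n. Y (f k) s)" for f s
  have abs_prod: "\<bar>\<Prod>k<n. Y (f k) s\<bar> \<le> (\<Prod>k<n. H (f k))" if "f \<in> P" for f s
    unfolding abs_prod by (intro prod_mono) (use that in \<open>auto simp: P_def intro!: le\<close>)
  have int: "set_integrable lborel {a..b} (G f)" if "f \<in> P" for f
  proof (rule set_integrable_Icc_bounded)
    have "Y (f k) \<in> borel_measurable borel" if "k \<in> {..<n}" for k
      using that \<open>f \<in> P\<close> by (auto simp: P_def intro!: Y)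
    then show "G f \<in> borel_measurable borel" unfolding G_def by measurable
    show "\<bar>G f s\<bar> \<le> 2 * (\<Prod>k<n. H (f k))" for s
      using abs_prod[OF that, of s] unfolding G_def by linarith
  qed
  have G0: "0 \<le> G f s" if "f \<in> P" for f s
    using abs_prod[OF that, of s] unfolding G_def by linarith
  have expand: "(\<Sum>i<m. lam i * H i) ^ n - (\<Sum>i<m. lam i * Y i s) ^ n
     = (\<Sum>f\<in>P. G f s * (\<Prod>k<n. lam (f k)))" for lam s
    using prod_linear_forms[of lam "\<lambda>_. H" m n] prod_linear_forms[of lam "\<lambda>_ i. Y i s" m n]
    by (simp add: P_def G_def sum_subtractf left_diff_distrib)
  have "(LBINT s:{a..b}. (\<Sum>i<m. lam i * H i) ^ n - (\<Sum>i<m. lam i * Y i s) ^ n)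
     = (\<Sum>f\<in>P. (LBINT s:{a..b}. G f s) * (\<Prod>k<n. lam (f k)))" for lam
  proof -
    have "(LBINT s:{a..b}. (\<Sum>i<m. lam i * H i) ^ n - (\<Sum>i<m. lam i * Y i s) ^ n)
       = (LBINT s. (\<Sum>f\<in>P. (indicator {a..b} s *\<^sub>R G f s) * (\<Prod>k<n. lam (f k))))"
      unfolding expand set_lebesgue_integral_def by (simp add: sum_distrib_left mult.assoc)
    also have "\<dots> = (\<Sum>f\<in>P. LBINT s. (indicator {a..b} s *\<^sub>R G f s) * (\<Prod>k<n. lam (f k)))"
      by (intro Bochner_Integration.integral_sum integrable_mult_left)
        (use int in \<open>auto simp: set_integrable_def\<close>)
    also have "\<dots> = (\<Sum>f\<in>P. (LBINT s:{a..b}. G f s) * (\<Prod>k<n. lam (f k)))"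
      unfolding set_lebesgue_integral_def by simp
    finally show ?thesis .
  qed
  moreover have "0 \<le> (LBINT s:{a..b}. G f s)" if "f \<in> P" for f
    unfolding set_lebesgue_integral_def using G0[OF that] by (intro integral_nonneg_AE) auto
  ultimately show ?thesis
    unfolding homogeneous_nonneg_def P_def[symmetric]
    by (intro exI[of _ "\<lambda>f. LBINT s:{a..b}. G f s"]) auto
qed

text \<open>Bolzano-Weierstrass one index at a time: each new index costs a further subsequence,
  which preserves the limits already obtained.\<close>

lemma bounded_finite_family_convergent_subsequence:
  fixes C :: "nat \<Rightarrow> 'b \<Rightarrow> real"
  assumes "finite A" "\<And>f. f \<in> A \<Longrightarrow> bounded (range (\<lambda>j. C j f))"
  shows "\<exists>r l. strict_mono (r :: nat \<Rightarrow> nat) \<and> (\<forall>f\<in>A. (\<lambda>j. C (r j) f) \<longlonglongrightarrow> l f)"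
  using assms
proof (induction A rule: finite_induct)
  case empty
  show ?case by (rule exI[of _ id]) (auto simp: strict_mono_def)
next
  case (insert a A)
  then obtain r l where r: "strict_mono (r :: nat \<Rightarrow> nat)" "\<And>f. f \<in> A \<Longrightarrow> (\<lambda>j. C (r j) f) \<longlonglongrightarrow> l f"
    by auto
  have "bounded (range (\<lambda>j. C (r j) a))"
    by (rule bounded_subset[of "range (\<lambda>j. C j a)"]) (use insert.prems in auto)
  then obtain l' s where s: "strict_mono (s :: nat \<Rightarrow> nat)" "((\<lambda>j. C (r j) a) \<circ> s) \<longlonglongrightarrow> l'"
    using bounded_imp_convergent_subsequence by blast
  have "(\<lambda>j. C ((r \<circ> s) j) f) \<longlonglongrightarrow> (l(a := l')) f" if "f \<in> insert a A" for f
  proof (cases "f = a")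
    case True then show ?thesis using s(2) by (simp add: o_def)
  next
    case False
    then show ?thesis using LIMSEQ_subseq_LIMSEQ[OF r(2) s(1), of f] that by (simp add: o_def)
  qed
  then show ?case using strict_mono_o[OF r(1) s(1)] by blast
qed

text \<open>Nonnegativity makes the coefficients bounded: none exceeds the value at the all-ones
  vector, and these values converge. Along a subsequence all coefficients converge, and their limits
  represent \<open>G\<close>.\<close>

lemma homogeneous_nonneg_LIMSEQ:
  assumes F: "\<And>j. homogeneous_nonneg m n (F j)"
    and lim: "\<And>lam. (\<And>i. i < m \<Longrightarrow> 0 \<le> lam i) \<Longrightarrow> (\<lambda>j. F j lam) \<longlonglongrightarrow> G lam"
  shows "homogeneous_nonneg m n G"
proof -
  define P where "P = {..<n} \<rightarrow>\<^sub>E {..<m}"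
  have fin: "finite P" unfolding P_def by (intro finite_PiE) auto
  have "\<forall>j. \<exists>C. (\<forall>f\<in>P. 0 \<le> C f) \<and>
       (\<forall>lam. (\<forall>i<m. 0 \<le> lam i) \<longrightarrow> F j lam = (\<Sum>f\<in>P. C f * (\<Prod>k<n. lam (f k))))"
    using F unfolding homogeneous_nonneg_def P_def by blast
  then obtain C where C0: "\<And>j f. f \<in> P \<Longrightarrow> 0 \<le> C j f"
    and C: "\<And>j lam. (\<forall>i<m. 0 \<le> lam i) \<Longrightarrow> F j lam = (\<Sum>f\<in>P. C j f * (\<Prod>k<n. lam (f k)))"
    by metis
  have "convergent (\<lambda>j. F j (\<lambda>_. 1))"
    using lim[of "\<lambda>_. 1"] by (auto simp: convergent_def)
  then obtain B where "\<forall>j. norm (F j (\<lambda>_. 1)) \<le> B"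
    by (meson convergent_imp_Bseq BseqE)
  then have B: "F j (\<lambda>_. 1) \<le> B" for j
    by (metis abs_le_D1 real_norm_def)
  \<comment> \<open>Evaluating at the all-ones vector bounds every coefficient.\<close>
  have "C j f \<le> B" if "f \<in> P" for j f
  proof -
    have "C j f \<le> (\<Sum>f\<in>P. C j f)" by (rule member_le_sum) (use that fin C0 in auto)
    also have "\<dots> = F j (\<lambda>_. 1)" by (subst C) auto
    finally show ?thesis using B[of j] by linarith
  qed
  then have "bounded (range (\<lambda>j. C j f))" if "f \<in> P" for f
    using that C0[OF that] by (intro boundedI[of _ B]) auto
  then obtain r l where r: "strict_mono (r :: nat \<Rightarrow> nat)" "\<And>f. f \<in> P \<Longrightarrow> (\<lambda>j. C (r j) f) \<longlonglongrightarrow> l f"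
    using bounded_finite_family_convergent_subsequence[OF fin, of C] by blast
  have "0 \<le> l f" if "f \<in> P" for f
    using LIMSEQ_le_const[OF r(2)[OF that], of 0] C0[OF that] by blast
  moreover have "G lam = (\<Sum>f\<in>P. l f * (\<Prod>k<n. lam (f k)))" if "\<forall>i<m. 0 \<le> lam i" for lam
  proof (rule LIMSEQ_unique)
    show "(\<lambda>j. F (r j) lam) \<longlonglongrightarrow> G lam"
      using LIMSEQ_subseq_LIMSEQ[OF lim r(1), of lam] that by (simp add: o_def)
    show "(\<lambda>j. F (r j) lam) \<longlonglongrightarrow> (\<Sum>f\<in>P. l f * (\<Prod>k<n. lam (f k)))"
      unfolding C[OF that] by (intro tendsto_sum tendsto_mult_right r(2))
  qed
  ultimately show ?thesis unfolding homogeneous_nonneg_def P_def[symmetric] by blast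
qed

subsection \<open>Subgradients and one-dimensional integrals\<close>

text \<open>Adding the subgradient inequalities for (s, t) and (t, s) eliminates
  \<open>h\<close>.\<close>

lemma antimono_subgradient:
  fixes h Y :: "real \<Rightarrow> real"
  assumes sub: "\<And>s t. h s - (t - s) * Y s \<le> h t"
  shows "antimono Y"
proof (rule antimonoI)
  fix s t :: real assume "s \<le> t"
  show "Y t \<le> Y s"
  proof (cases "s = t")
    case False
    have "(t - s) * (Y t - Y s) \<le> 0"
      using sub[of s t] sub[of t s] by (simp add: algebra_simps)
    then show ?thesis using \<open>s \<le> t\<close> False by (simp add: mult_le_0_iff)
  qed simp
qed

lemma borel_measurable_antimono:
  fixes Y :: "real \<Rightarrow> real"
  assumes "antimono Y" shows "Y \<in> borel_measurable borel"
proof -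
  have "mono (\<lambda>s. - Y s)" using assms by (auto simp: mono_def antimono_def)
  then have "(\<lambda>s. - (- Y s)) \<in> borel_measurable borel"
    by (intro borel_measurable_uminus borel_measurable_mono)
  then show ?thesis by simp
qed

text \<open>The fundamental theorem for a convex function with subgradient \<open>- Y\<close>,
  without differentiability. The error \<open>D\<close> is additive over adjacent intervals and at
  most the length times the drop of \<open>Y\<close>. On equal pieces the drops telescope, so the
  error is at most a constant divided by the number of pieces.\<close>

lemma integral_subgradient:
  fixes h Y :: "real \<Rightarrow> real"
  assumes sub: "\<And>s t. h s - (t - s) * Y s \<le> h t" and "a \<le> b"
  shows "integral {a..b} Y = h a - h b"
proof -
  have anti: "Y t \<le> Y s" if "s \<le> t" for s t
    using antimonoD[OF antimono_subgradient[OF sub] that] .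
  have int: "Y integrable_on {a..b}" for a b
  proof -
    have "set_integrable lborel {a..b} Y"
      by (rule set_integrable_Icc_bounded[where B = "max \<bar>Y a\<bar> \<bar>Y b\<bar>"])
        (use anti[of a] anti[of _ b] in \<open>auto intro!: borel_measurable_antimono antimono_subgradient[OF sub] simp: abs_le_iff le_max_iff_disj, force+\<close>)
    then show ?thesis by (rule set_borel_integral_eq_integral(1))
  qed
  define D where "D a b = integral {a..b} Y - (h a - h b)" for a b
  have D: "\<bar>D a b\<bar> \<le> (b - a) * (Y a - Y b)" if "a \<le> b" for a b
  proof -
    have "integral {a..b} Y \<le> integral {a..b} (\<lambda>_. Y a)"
      by (intro integral_le int) (auto intro: anti)
    moreover have "integral {a..b} (\<lambda>_. Y b) \<le> integral {a..b} Y"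
      by (intro integral_le int) (auto intro: anti)
    ultimately show ?thesis
      using sub[of a b] sub[of b a] that unfolding D_def by (simp add: algebra_simps abs_le_iff)
  qed
  have split: "D a c = D a b + D b c" if "a \<le> b" "b \<le> c" for a b c
    unfolding D_def using Henstock_Kurzweil_Integration.integral_combine[OF that int] by simp
  have step: "\<bar>D a (a + real n * d)\<bar> \<le> d * (Y a - Y (a + real n * d))" if "0 \<le> d" for n d
  proof (induction n)
    case 0 show ?case using D[of a a] by simp
  next
    case (Suc n)
    have "D a (a + real (Suc n) * d) = D a (a + real n * d) + D (a + real n * d) (a + real (Suc n) * d)"
      by (rule split) (use that in \<open>auto simp: algebra_simps\<close>)
    moreover have "\<bar>D (a + real n * d) (a + real (Suc n) * d)\<bar>
        \<le> d * (Y (a + real n * d) - Y (a + real (Suc n) * d))"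
      using D[of "a + real n * d" "a + real (Suc n) * d"] that by (simp add: algebra_simps)
    ultimately show ?case using Suc by (simp add: algebra_simps)
  qed
  have bound: "\<bar>D a b\<bar> \<le> (b - a) * (Y a - Y b) / real (Suc n)" for n
    using step[of "(b - a) / real (Suc n)" "Suc n"] \<open>a \<le> b\<close> by (simp del: of_nat_Suc)
  have "(\<lambda>n. (b - a) * (Y a - Y b) / real (Suc n)) \<longlonglongrightarrow> 0"
    by (intro LIMSEQ_Suc lim_const_over_n)
  then have "\<bar>D a b\<bar> \<le> 0" by (rule LIMSEQ_le_const) (use bound in auto)
  then show ?thesis unfolding D_def by simp
qed

lemma has_real_derivative_power_Suc_div:
  "((\<lambda>y::real. y ^ Suc n / real (Suc n)) has_real_derivative y ^ n) (at y within S)"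
  using DERIV_cdivide[OF DERIV_pow[of "Suc n" y S], of "real (Suc n)"] by (simp del: of_nat_Suc)

text \<open>The integrand is split at \<open>c\<close>, where the absolute value changes sign. This
  is the inner integral of the later Fubini argument, with \<open>c\<close> the height of a support
  point.\<close>

lemma integral_power_abs_diff:
  fixes H c :: real
  assumes "\<bar>c\<bar> \<le> H"
  shows "integral {-H..H} (\<lambda>y. y ^ (2*q) * \<bar>y - c\<bar>)
    = 2 * c ^ (2*q+2) / ((2 * real q + 1) * (2 * real q + 2))
      + 2 * H ^ (2*q+2) / (2 * real q + 1) - 2 * H ^ (2*q+2) / ((2 * real q + 1) * (2 * real q + 2))"
proof -
  \<comment> \<open>An antiderivative of \<open>y ^ (2*q) * (c - y)\<close>. Its first term is odd
    and cancels in \<open>F (-H) + F H\<close>, so the contribution of the endpoints does not depend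
    on \<open>c\<close>.\<close>
  define F where "F y = c * y ^ (2*q+1) / (2 * real q + 1) - y ^ (2*q+2) / (2 * real q + 2)" for y
  have F: "(F has_real_derivative y ^ (2*q) * (c - y)) (at y within S)" for y S
    using DERIV_diff[OF DERIV_cmult[OF has_real_derivative_power_Suc_div[of "2*q" y S], of c]
        has_real_derivative_power_Suc_div[of "2*q+1" y S]]
    by (simp add: F_def[abs_def] algebra_simps)
  have F1: "((\<lambda>y. y ^ (2*q) * (c - y)) has_integral (F c - F (-H))) {-H..c}"
    by (rule fundamental_theorem_of_calculus)
      (use assms F in \<open>auto simp: has_real_derivative_iff_has_vector_derivative[symmetric]\<close>)
  have "((\<lambda>y. y ^ (2*q) * (c - y)) has_integral (F H - F c)) {c..H}"
    by (rule fundamental_theorem_of_calculus)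
      (use assms F in \<open>auto simp: has_real_derivative_iff_has_vector_derivative[symmetric]\<close>)
  then have F2: "((\<lambda>y. - (y ^ (2*q) * (c - y))) has_integral - (F H - F c)) {c..H}"
    by (rule has_integral_neg)
  have G1: "((\<lambda>y. y ^ (2*q) * \<bar>y - c\<bar>) has_integral (F c - F (-H))) {-H..c}"
    by (rule has_integral_eq[OF _ F1]) auto
  have G2: "((\<lambda>y. y ^ (2*q) * \<bar>y - c\<bar>) has_integral - (F H - F c)) {c..H}"
    by (rule has_integral_eq[OF _ F2]) (auto simp: algebra_simps)
  have "((\<lambda>y. y ^ (2*q) * \<bar>y - c\<bar>) has_integral (F c - F (-H)) + - (F H - F c)) {-H..H}"
    by (rule has_integral_combine[OF _ _ G1 G2]) (use assms in auto)
  then have "integral {-H..H} (\<lambda>y. y ^ (2*q) * \<bar>y - c\<bar>) = (F c - F (-H)) + - (F H - F c)"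
    by (rule integral_unique)
  also have "\<dots> = 2 * F c - (F (-H) + F H)" by simp
  also have "\<dots> = 2 * c ^ (2*q+2) / ((2 * real q + 1) * (2 * real q + 2))
      + 2 * H ^ (2*q+2) / (2 * real q + 1) - 2 * H ^ (2*q+2) / ((2 * real q + 1) * (2 * real q + 2))"
  proof -
    define u where "u = 2 * real q + 1"
    have "0 < u" by (simp add: u_def)
    have "F c = c ^ (2*q+2) / u - c ^ (2*q+2) / (u + 1)"
      by (simp add: F_def u_def add.commute)
    moreover have "F (-H) + F H = - (2 * (H ^ (2*q+2) / (u + 1)))"
      by (simp add: F_def u_def add.commute)
    moreover have "x / (u * (u + 1)) = x / u - x / (u + 1)" for x
      using \<open>0 < u\<close> by (simp add: divide_simps) (simp add: algebra_simps)
    moreover have u: "2 * real q + 1 = u" "2 * real q + 2 = u + 1" by (simp_all add: u_def)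
    ultimately show ?thesis unfolding u by simp
  qed
  finally show ?thesis .
qed

text \<open>Passes from the gauge integral of the theorem to the Lebesgue integral, where Fubini,
  dominated convergence and image measures are used.\<close>

lemma integral_compact_eq_LINT:
  fixes f :: "'a::euclidean_space \<Rightarrow> real"
  assumes "compact S" "continuous_on S f"
  shows "integrable lborel (\<lambda>x. indicator S x * f x)"
    and "integral S f = (LINT x|lborel. indicator S x * f x)"
proof -
  show int: "integrable lborel (\<lambda>x. indicator S x * f x)"
    using borel_integrable_compact[OF assms]
    by (simp add: indicator_def of_bool_def if_distrib if_distribR cong: if_cong)
  show "integral S f = (LINT x|lborel. indicator S x * f x)"
    using set_borel_integral_eq_integral(2)[of S f] int
    by (simp add: set_integrable_def set_lebesgue_integral_def)
qed


subsection \<open>Moments of a planar body\<close>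

text \<open>\<open>h s\<close> is the support function of \<open>L\<close> in direction \<open>(1, -s)\<close>, and \<open>Y s\<close> the height of
  a chosen support point.\<close>

locale planar_body =
  fixes L :: "(real \<times> real) set" and h Y :: "real \<Rightarrow> real" and H :: real
  assumes compact: "compact L" and convex: "convex L"
    and symmetric: "p \<in> L \<Longrightarrow> - p \<in> L"
    and support_le: "p \<in> L \<Longrightarrow> fst p - s * snd p \<le> h s"
    and support_point: "(h s + s * Y s, Y s) \<in> L"
    and height_le: "p \<in> L \<Longrightarrow> snd p \<le> H"
    and height_point: "\<exists>x. (x, H) \<in> L"
begin

text \<open>The support point for slope \<open>s\<close> is a competitor for slope
  \<open>t\<close>.\<close>

lemma subgradient: "h s - (t - s) * Y s \<le> h t"
  using support_le[OF support_point[of s], of t] by (simp add: algebra_simps)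

lemma abs_height_le: "p \<in> L \<Longrightarrow> \<bar>snd p\<bar> \<le> H"
  using height_le[of p] height_le[OF symmetric, of p] by (simp add: abs_le_iff)

lemma abs_Y_le: "\<bar>Y s\<bar> \<le> H"
  using abs_height_le[OF support_point[of s]] by simp

lemma Y_measurable [measurable]: "Y \<in> borel_measurable borel"
  by (rule borel_measurable_antimono[OF antimono_subgradient[OF subgradient]])

lemma H_nonneg: "0 \<le> H"
  using abs_Y_le[of 0] by linarith

text \<open>A highest point is tested with slope \<open>-M\<close> and its antipode with slope
  \<open>M\<close>; their first coordinates cancel in the sum.\<close>

lemma support_sum_ge: "2 * M * H \<le> h M + h (-M)"
proof -
  obtain x where x: "(x, H) \<in> L" using height_point by blast
  have "x + M * H \<le> h (-M)" "- x + M * H \<le> h M"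
    using support_le[OF x, of "-M"] support_le[OF symmetric[OF x], of M] by simp_all
  then show ?thesis by linarith
qed

section \<open>Horizontal chords of a symmetric convex body\<close>

definition chord_end :: "real \<Rightarrow> real" where "chord_end y = Sup {x. (x, y) \<in> L}"

lemma chord_compact: "compact {x. (x, y) \<in> L}"
proof -
  have "{x. (x, y) \<in> L} = fst ` (L \<inter> snd -` {y})" by force
  moreover have "compact (fst ` (L \<inter> snd -` {y}))"
    by (intro compact_continuous_image compact_Int_closed compact closed_vimage continuous_intros)
  ultimately show ?thesis by simp
qed

lemma chord_nonempty:
  assumes "\<bar>y\<bar> \<le> H" shows "\<exists>x. (x, y) \<in> L"
proof (cases "H = 0")
  case True then show ?thesis using assms height_point by auto
next
  case False
  obtain x where x: "(x, H) \<in> L" using height_point by blast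
  \<comment> \<open>Solves \<open>(2 * u - 1) * H = y\<close>: the point at height \<open>y\<close>
    is taken on the segment joining a highest point to its antipode.\<close>
  define u where "u = (1 + y / H) / 2"
  have "0 < H" using False H_nonneg by simp
  then have u: "0 \<le> u" "0 \<le> 1 - u" "u + (1 - u) = 1"
    using assms unfolding u_def by (auto simp: field_simps abs_le_iff)
  have "u *\<^sub>R (x, H) + (1 - u) *\<^sub>R (- (x, H)) \<in> L"
    using convexD[OF convex x symmetric[OF x] u] .
  moreover have "u *\<^sub>R (x, H) + (1 - u) *\<^sub>R (- (x, H)) = ((2 * u - 1) * x, y)"
    using \<open>0 < H\<close> unfolding u_def by (simp add: field_simps)
  ultimately show ?thesis by auto
qed

lemma chord_end_mem: "\<bar>y\<bar> \<le> H \<Longrightarrow> (chord_end y, y) \<in> L"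
  using closed_contains_Sup[of "{x. (x, y) \<in> L}"] chord_compact[of y] chord_nonempty[of y]
  by (auto simp: chord_end_def bounded_imp_bdd_above compact_imp_bounded compact_imp_closed)

lemma chord_end_ge: "(x, y) \<in> L \<Longrightarrow> x \<le> chord_end y"
  unfolding chord_end_def using chord_compact[of y]
  by (intro cSup_upper) (auto simp: bounded_imp_bdd_above compact_imp_bounded)

text \<open>Central symmetry sends the right end at height \<open>-y\<close> to the left end at
  height \<open>y\<close>, so \<open>chord_end\<close> alone describes the whole chord.\<close>

lemma chord_eq:
  assumes "\<bar>y\<bar> \<le> H" shows "{x. (x, y) \<in> L} = {- chord_end (-y)..chord_end y}"
proof (intro subset_antisym subsetI)
  fix x assume "x \<in> {x. (x, y) \<in> L}"
  then show "x \<in> {- chord_end (-y)..chord_end y}"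
    using chord_end_ge[of x y] chord_end_ge[of "-x" "-y"] symmetric[of "(x, y)"] by auto
next
  fix x assume x: "x \<in> {- chord_end (-y)..chord_end y}"
  have "(- chord_end (-y), y) \<in> L" using symmetric[OF chord_end_mem[of "-y"]] assms by simp
  then have "closed_segment (- chord_end (-y), y) (chord_end y, y) \<subseteq> L"
    using chord_end_mem[OF assms] convex by (simp add: closed_segment_subset)
  moreover have "(x, y) \<in> closed_segment (- chord_end (-y), y) (chord_end y, y)"
  proof -
    have "x \<in> closed_segment (- chord_end (-y)) (chord_end y)" using x by (auto simp: closed_segment_eq_real_ivl)
    then obtain u where "0 \<le> u" "u \<le> 1" "x = (1 - u) *\<^sub>R (- chord_end (-y)) + u *\<^sub>R chord_end y"
      by (auto simp: closed_segment_def)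
    then show ?thesis by (auto simp: closed_segment_def algebra_simps intro!: exI[of _ u])
  qed
  ultimately show "x \<in> {x. (x, y) \<in> L}" by auto
qed

section \<open>Chord ends as infima over support lines\<close>

lemma chord_end_le_support: "\<bar>y\<bar> \<le> H \<Longrightarrow> chord_end y \<le> h s + s * y"
  using support_le[OF chord_end_mem, of y s] by simp

text \<open>A point slightly to the right of the chord is separated from \<open>L\<close> by a line,
  which is shown not to be horizontal and so has a slope \<open>s\<close>. The slack
  \<open>e\<close> is essential at the extreme heights, where the infimum over slopes need not be
  attained.\<close>

lemma support_approx_chord_end:
  assumes "\<bar>y\<bar> \<le> H" "0 < e"
  shows "\<exists>s. h s + s * y \<le> chord_end y + e"
proof -
  have "(chord_end y + e, y) \<notin> L" using chord_end_ge[of "chord_end y + e" y] \<open>0 < e\<close> by auto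
  then obtain a c where a: "a \<bullet> (chord_end y + e, y) < c" "\<And>p. p \<in> L \<Longrightarrow> c < a \<bullet> p"
    using separating_hyperplane_closed_point[OF convex compact_imp_closed[OF compact], of "(chord_end y + e, y)"] by blast
  define a1 a2 where "a1 = fst a" "a2 = snd a"
  have a: "a1 * (chord_end y + e) + a2 * y < a1 * fst p + a2 * snd p" if "p \<in> L" for p
    using a(1) a(2)[OF that] by (simp add: inner_prod_def a1_a2_def)
  \<comment> \<open>The chord end and the excluded point have equal height, so comparing them
    isolates the first component of the normal.\<close>
  have "a1 * e < 0" using a[OF chord_end_mem[OF assms(1)]] by (simp add: algebra_simps)
  then have "a1 < 0" using \<open>0 < e\<close> by (simp add: mult_less_0_iff)
  \<comment> \<open>The normal becomes \<open>a1\<close> times (1, -s); dividing by the negative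
    \<open>a1\<close> turns the separation into an upper bound on \<open>h s\<close>.\<close>
  define s where "s = - a2 / a1"
  have a2: "a2 = - s * a1" using \<open>a1 < 0\<close> by (simp add: s_def)
  have "a1 * (chord_end y + e - s * y) < a1 * (h s)"
    using a[OF support_point[of s]] unfolding a2 by (simp add: algebra_simps)
  then have "h s < chord_end y + e - s * y" using \<open>a1 < 0\<close> by simp
  then show ?thesis by (intro exI[of _ s]) simp
qed

text \<open>This is the minimum of \<open>h s + s * y\<close> over \<open>\<bar>s\<bar> \<le> M\<close>; unlike that minimum, the formula is
  accessible to Fubini's theorem.\<close>

definition chord_end_trunc :: "real \<Rightarrow> real \<Rightarrow> real" where
  "chord_end_trunc M y = (h M + h (-M)) / 2 - (LBINT s:{-M..M}. \<bar>y - Y s\<bar>) / 2"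

lemma abs_diff_Y_integrable: "set_integrable lborel {a..c} (\<lambda>s. \<bar>y - Y s\<bar>)"
proof (rule set_integrable_Icc_bounded[where B = "\<bar>y\<bar> + H"])
  show "\<bar>\<bar>y - Y s\<bar>\<bar> \<le> \<bar>y\<bar> + H" for s using abs_Y_le[of s] by linarith
qed measurable

lemma Y_integrable_on: "Y integrable_on {a..c}"
  by (rule set_borel_integral_eq_integral(1)[OF set_integrable_Icc_bounded[where B = H]])
    (auto simp: abs_Y_le)

lemma integral_diff_Y:
  assumes "a \<le> c"
  shows "(h c + c * y) - (h a + a * y) = integral {a..c} (\<lambda>s. y - Y s)"
  using integral_subgradient[OF subgradient assms] assms
  by (subst Henstock_Kurzweil_Integration.integral_diff[OF _ Y_integrable_on])
    (auto simp: algebra_simps)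

text \<open>Moves \<open>h M\<close> and \<open>h (-M)\<close> to a reference slope \<open>t\<close>
  by integrating \<open>y - Y s\<close>, the derivative of \<open>h s + s * y\<close>. The two
  integrals subtracted are nonnegative, and both vanish if \<open>y - Y s\<close> changes sign from
  nonpositive to nonnegative at \<open>t\<close>. These two facts give the upper and the lower bound
  that follow.\<close>

lemma chord_end_trunc_split:
  assumes "\<bar>t\<bar> \<le> M"
  shows "2 * chord_end_trunc M y = 2 * (h t + t * y)
     - integral {-M..t} (\<lambda>s. \<bar>y - Y s\<bar> + (y - Y s)) - integral {t..M} (\<lambda>s. \<bar>y - Y s\<bar> - (y - Y s))"
proof -
  have int: "(\<lambda>s. \<bar>y - Y s\<bar>) integrable_on {a..c}" for a c
    by (rule set_borel_integral_eq_integral(1)[OF abs_diff_Y_integrable])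
  have int': "(\<lambda>s. y - Y s) integrable_on {a..c}" for a c
    by (intro integrable_diff Y_integrable_on) auto
  have "(LBINT s:{-M..M}. \<bar>y - Y s\<bar>) = integral {-M..M} (\<lambda>s. \<bar>y - Y s\<bar>)"
    by (rule set_borel_integral_eq_integral(2)[OF abs_diff_Y_integrable])
  also have "\<dots> = integral {-M..t} (\<lambda>s. \<bar>y - Y s\<bar>) + integral {t..M} (\<lambda>s. \<bar>y - Y s\<bar>)"
    by (rule Henstock_Kurzweil_Integration.integral_combine[symmetric]) (use assms int in auto)
  finally have "2 * chord_end_trunc M y = (h M + M * y) + (h (-M) - M * y)
      - integral {-M..t} (\<lambda>s. \<bar>y - Y s\<bar>) - integral {t..M} (\<lambda>s. \<bar>y - Y s\<bar>)"
    unfolding chord_end_trunc_def by (simp only:) (simp add: field_simps)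
  moreover have "h M + M * y = (h t + t * y) + integral {t..M} (\<lambda>s. y - Y s)"
    using integral_diff_Y[of t M y] assms by (simp add: algebra_simps)
  moreover have "h (-M) - M * y = (h t + t * y) - integral {-M..t} (\<lambda>s. y - Y s)"
    using integral_diff_Y[of "-M" t y] assms by (simp add: algebra_simps)
  ultimately have "2 * chord_end_trunc M y = ((h t + t * y) + integral {t..M} (\<lambda>s. y - Y s))
      + ((h t + t * y) - integral {-M..t} (\<lambda>s. y - Y s))
      - integral {-M..t} (\<lambda>s. \<bar>y - Y s\<bar>) - integral {t..M} (\<lambda>s. \<bar>y - Y s\<bar>)"
    by (simp only:)
  note eq = this
  have rearrange: "B = (a + p2) + (a - p1) - A1 - A2 \<Longrightarrow> B = 2 * a - (A1 + p1) - (A2 - p2)"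
    for B a p1 p2 A1 A2 :: real by linarith
  show ?thesis
    unfolding Henstock_Kurzweil_Integration.integral_add[OF int int']
       Henstock_Kurzweil_Integration.integral_diff[OF int int'] by (rule rearrange[OF eq])
qed

lemma chord_end_trunc_le_support:
  assumes "\<bar>t\<bar> \<le> M" shows "chord_end_trunc M y \<le> h t + t * y"
proof -
  have "0 \<le> integral {-M..t} (\<lambda>s. \<bar>y - Y s\<bar> + (y - Y s))"
    "0 \<le> integral {t..M} (\<lambda>s. \<bar>y - Y s\<bar> - (y - Y s))"
    by (rule Henstock_Kurzweil_Integration.integral_nonneg;
        auto intro!: integrable_add integrable_diff Y_integrable_on
          set_borel_integral_eq_integral(1)[OF abs_diff_Y_integrable])+
  moreover have "B = 2 * R - I - J \<Longrightarrow> 0 \<le> I \<Longrightarrow> 0 \<le> J \<Longrightarrow> B \<le> 2 * R" for B R I J :: real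
    by linarith
  ultimately have "2 * chord_end_trunc M y \<le> 2 * (h t + t * y)" using chord_end_trunc_split[OF assms, of y] by blast
  then show ?thesis by simp
qed

lemma chord_end_trunc_ge:
  assumes "0 \<le> M" "\<bar>y\<bar> \<le> H" shows "chord_end y \<le> chord_end_trunc M y"
proof -
  \<comment> \<open>The supremum \<open>t\<close> of this set is where \<open>y - Y s\<close>
    changes sign, as \<open>Y\<close> is decreasing. Inserting \<open>-M\<close> keeps the set
    nonempty when \<open>Y\<close> stays below \<open>y\<close> on the whole interval.\<close>
  define T where "T = insert (-M) {s. \<bar>s\<bar> \<le> M \<and> y \<le> Y s}"
  define t where "t = Sup T"
  have bdd: "bdd_above T" unfolding T_def bdd_above_def using \<open>0 \<le> M\<close> by (intro exI[of _ M]) auto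
  have anti: "Y v \<le> Y u" if "u \<le> v" for u v
    using antimonoD[OF antimono_subgradient[OF subgradient] that] .
  have "-M \<le> t" unfolding t_def by (rule cSup_upper[OF _ bdd]) (simp add: T_def)
  moreover have "t \<le> M" unfolding t_def by (rule cSup_least) (use \<open>0 \<le> M\<close> in \<open>auto simp: T_def\<close>)
  ultimately have t: "\<bar>t\<bar> \<le> M" by simp
  have left: "y \<le> Y s" if "-M \<le> s" "s < t" for s
  proof -
    obtain u where "u \<in> T" "s < u" using \<open>s < t\<close> less_cSup_iff[of T s] bdd unfolding t_def T_def by auto
    then show ?thesis using that anti[of s u] unfolding T_def by auto
  qed
  have right: "Y s < y" if "t < s" "s \<le> M" for s
  proof (rule ccontr)
    assume "\<not> Y s < y"
    then have "s \<in> T" unfolding T_def using that t by auto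
    then have "s \<le> t" unfolding t_def using bdd by (rule cSup_upper)
    then show False using that by simp
  qed
  \<comment> \<open>Both integrands vanish except possibly at \<open>t\<close> itself, where the
    sign of \<open>y - Y t\<close> is unknown; a single point is negligible.\<close>
  have "integral {-M..t} (\<lambda>s. \<bar>y - Y s\<bar> + (y - Y s)) = integral {-M..t} (\<lambda>s. 0)"
    by (rule integral_spike[of "{t}"]) (use left in auto)
  moreover have "integral {t..M} (\<lambda>s. \<bar>y - Y s\<bar> - (y - Y s)) = integral {t..M} (\<lambda>s. 0)"
    by (rule integral_spike[of "{t}"]) (use right in force)+
  ultimately have "chord_end_trunc M y = h t + t * y" using chord_end_trunc_split[OF t, of y] by simp
  then show ?thesis using chord_end_le_support[OF assms(2), of t] by simp
qed

lemma chord_end_trunc_LIMSEQ: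
  assumes "\<bar>y\<bar> \<le> H" shows "(\<lambda>n. chord_end_trunc (real n) y) \<longlonglongrightarrow> chord_end y"
proof (rule LIMSEQ_I)
  fix e :: real assume "0 < e"
  then obtain s where s: "h s + s * y \<le> chord_end y + e / 2" using support_approx_chord_end[OF assms, of "e / 2"] by auto
  \<comment> \<open>From \<open>N\<close> on, the nearly optimal slope \<open>s\<close> lies in the
    truncation range, so its support line bounds the truncated value from above.\<close>
  obtain N where N: "\<bar>s\<bar> \<le> real N" using real_arch_simple by blast
  have "norm (chord_end_trunc (real n) y - chord_end y) < e" if "N \<le> n" for n
    using chord_end_trunc_le_support[of s "real n" y] chord_end_trunc_ge[OF _ assms, of "real n"] s N that \<open>0 < e\<close> by simp
  then show "\<exists>N. \<forall>n\<ge>N. norm (chord_end_trunc (real n) y - chord_end y) < e" by blast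
qed

text \<open>A bound uniform in \<open>M\<close> and \<open>y\<close>, which later dominates the
  truncations. The upper half is the support line of slope 0, and the lower half follows by
  symmetry.\<close>

lemma abs_chord_end_trunc_le:
  assumes "0 \<le> M" "\<bar>y\<bar> \<le> H" shows "\<bar>chord_end_trunc M y\<bar> \<le> h 0"
proof -
  have "- h 0 \<le> chord_end y"
    using chord_end_mem[OF assms(2)] support_le[OF symmetric, of "(chord_end y, y)" 0] by simp
  then show ?thesis using chord_end_trunc_ge[OF assms] chord_end_trunc_le_support[of 0 M y] assms(1) by simp
qed

section \<open>Even moments of the truncated chord ends and their limit\<close>

lemma chord_end_trunc_measurable [measurable]: "chord_end_trunc M \<in> borel_measurable borel"
  unfolding chord_end_trunc_def set_lebesgue_integral_def by measurable

text \<open>After Fubini the integral over \<open>y\<close> is explicit for each slope. The terms in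
  \<open>h M\<close>, \<open>h (-M)\<close> and \<open>M * H\<close> combine into the nonnegative
  width defect \<open>h M + h (-M) - 2 * M * H\<close>.\<close>

lemma power_chord_end_trunc_integral:
  assumes "0 \<le> M"
  shows "(LBINT y:{-H..H}. y ^ (2*q) * chord_end_trunc M y) =
     H ^ (2*q+1) * (h M + h (-M) - 2 * M * H) / (2 * real q + 1)
     + (LBINT s:{-M..M}. H ^ (2*q+2) - Y s ^ (2*q+2)) / ((2 * real q + 1) * (2 * real q + 2))"
proof -
  define A where "A = 1 / (2 * real q + 1)"
  define B where "B = 1 / ((2 * real q + 1) * (2 * real q + 2))"
  have pw: "\<bar>y ^ k\<bar> \<le> H ^ k" if "\<bar>y\<bar> \<le> H" for y k
    using that by (simp add: power_abs power_mono)
  \<comment> \<open>Arranged so that \<open>Y s\<close> enters only through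
    \<open>H ^ (2*q+2) - Y s ^ (2*q+2)\<close>, the part whose polynomial expansion has nonnegative
    coefficients.\<close>
  have inner: "(LBINT y:{-H..H}. y ^ (2*q) * \<bar>y - Y s\<bar>) = 2 * A * H ^ (2*q+2) - 2 * B * (H ^ (2*q+2) - Y s ^ (2*q+2))" for s
  proof -
    have "set_integrable lborel {-H..H} (\<lambda>y. y ^ (2*q) * \<bar>y - Y s\<bar>)"
    proof (rule set_integrable_Icc_bounded[where B = "H ^ (2*q) * (2 * H)"])
      fix y assume "y \<in> {-H..H}"
      then have y: "\<bar>y\<bar> \<le> H" by auto
      show "\<bar>y ^ (2*q) * \<bar>y - Y s\<bar>\<bar> \<le> H ^ (2*q) * (2 * H)"
        unfolding abs_mult by (intro mult_mono pw y) (use y abs_Y_le[of s] H_nonneg in auto)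
    qed measurable
    then show ?thesis
      using integral_power_abs_diff[OF abs_Y_le[of s], of q]
      by (simp add: set_borel_integral_eq_integral A_def B_def diff_divide_distrib algebra_simps)
  qed
  have "(LBINT y:{-H..H}. y ^ (2*q) * (LBINT s:{-M..M}. \<bar>y - Y s\<bar>))
     = (LBINT y. LBINT s. indicator {-H..H} y * indicator {-M..M} s * (y ^ (2*q) * \<bar>y - Y s\<bar>))"
    unfolding set_lebesgue_integral_def
    by (simp add: integral_mult_right_zero[symmetric] ac_simps del: integral_mult_right_zero)
  also have "\<dots> = (LBINT s. LBINT y. indicator {-H..H} y * indicator {-M..M} s * (y ^ (2*q) * \<bar>y - Y s\<bar>))"
  proof (rule lborel_pair.Fubini_integral[symmetric])
    show "integrable (lborel \<Otimes>\<^sub>M lborel) (\<lambda>(y, s). indicator {-H..H} y * indicator {-M..M} s * (y ^ (2*q) * \<bar>y - Y s\<bar>))"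
    proof (rule integrableI_bounded_set[where B = "H ^ (2*q) * (2 * H)" and A = "{-H..H} \<times> {-M..M}"])
      show "emeasure (lborel \<Otimes>\<^sub>M lborel) ({- H..H} \<times> {- M..M}) < \<infinity>"
        using H_nonneg assms
        by (subst lborel.emeasure_pair_measure_Times) (auto simp: ennreal_mult_less_top)
      have "\<bar>y ^ (2*q)\<bar> * \<bar>y - Y s\<bar> \<le> H ^ (2*q) * (2 * H)" if y: "\<bar>y\<bar> \<le> H" for y s
        by (intro mult_mono pw y) (use y abs_Y_le[of s] H_nonneg in auto)
      then show "AE p\<in>{-H..H} \<times> {-M..M} in lborel \<Otimes>\<^sub>M lborel.
        norm (case p of (y, s) \<Rightarrow> indicator {-H..H} y * indicator {-M..M} s * (y ^ (2*q) * \<bar>y - Y s\<bar>)) \<le> H ^ (2*q) * (2 * H)"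
        by (intro AE_I2) (auto simp: indicator_def abs_mult)
    qed (auto simp: indicator_def)
  qed
  also have "\<dots> = (LBINT s:{-M..M}. LBINT y:{-H..H}. y ^ (2*q) * \<bar>y - Y s\<bar>)"
    unfolding set_lebesgue_integral_def
    by (simp add: integral_mult_right_zero[symmetric] ac_simps del: integral_mult_right_zero)
  also have "\<dots> = (LBINT s:{-M..M}. 2 * A * H ^ (2*q+2) - 2 * B * (H ^ (2*q+2) - Y s ^ (2*q+2)))"
    unfolding inner ..
  also have "\<dots> = 4 * M * A * H ^ (2*q+2) - 2 * B * (LBINT s:{-M..M}. H ^ (2*q+2) - Y s ^ (2*q+2))"
  proof -
    have "set_integrable lborel {-M..M} (\<lambda>s. H ^ (2*q+2) - Y s ^ (2*q+2))"
    proof (rule set_integrable_Icc_bounded[where B = "2 * H ^ (2*q+2)"])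
      show "\<bar>H ^ (2*q+2) - Y s ^ (2*q+2)\<bar> \<le> 2 * H ^ (2*q+2)" for s
        using pw[OF abs_Y_le[of s], of "2*q+2"] pw[of H "2*q+2"] H_nonneg by linarith
    qed measurable
    moreover have "set_integrable lborel {-M..M} (\<lambda>s. 2 * A * H ^ (2*q+2))"
      by (rule set_integrable_Icc_bounded) auto
    moreover have "(LBINT s:{-M..M}. 2 * A * H ^ (2*q+2)) = 4 * M * A * H ^ (2*q+2)"
      using assms by (simp add: set_integral_const)
    ultimately show ?thesis
      by (subst set_integral_diff) auto
  qed
  finally have fub: "(LBINT y:{-H..H}. y ^ (2*q) * (LBINT s:{-M..M}. \<bar>y - Y s\<bar>))
     = 4 * M * A * H ^ (2*q+2) - 2 * B * (LBINT s:{-M..M}. H ^ (2*q+2) - Y s ^ (2*q+2))" .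
  have mom: "(LBINT y:{-H..H}. y ^ (2*q)) = 2 * A * H ^ (2*q+1)"
  proof -
    have "((\<lambda>y. y ^ (2*q)) has_integral (H ^ Suc (2*q) / real (Suc (2*q)) - (-H) ^ Suc (2*q) / real (Suc (2*q)))) {-H..H}"
      by (rule fundamental_theorem_of_calculus)
        (use H_nonneg has_real_derivative_power_Suc_div[of "2*q"] in
          \<open>auto simp: has_real_derivative_iff_has_vector_derivative[symmetric] simp del: of_nat_Suc power_Suc\<close>)
    moreover have "set_integrable lborel {-H..H} (\<lambda>y. y ^ (2*q))"
    proof (rule set_integrable_Icc_bounded)
      show "\<bar>y ^ (2*q)\<bar> \<le> H ^ (2*q)" if "y \<in> {-H..H}" for y
        by (rule pw) (use that in auto)
    qed measurable
    ultimately have "(LBINT y:{-H..H}. y ^ (2*q)) = H ^ Suc (2*q) / real (Suc (2*q)) - (-H) ^ Suc (2*q) / real (Suc (2*q))"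
      using set_borel_integral_eq_integral(2) integral_unique by metis
    then show ?thesis by (simp add: A_def add.commute)
  qed
  \<comment> \<open>The truncated end is split into its constant half-sum of \<open>h M\<close> and
    \<open>h (-M)\<close> and the remainder, which is minus half of the integral over slopes treated
    by Fubini.\<close>
  have I1: "set_integrable lborel {-H..H} (\<lambda>y. y ^ (2*q) * ((h M + h (-M)) / 2))"
    and I2: "set_integrable lborel {-H..H} (\<lambda>y. y ^ (2*q) * (chord_end_trunc M y - (h M + h (-M)) / 2))"
  proof -
    show "set_integrable lborel {-H..H} (\<lambda>y. y ^ (2*q) * ((h M + h (-M)) / 2))"
    proof (rule set_integrable_Icc_bounded)
      show "\<bar>y ^ (2*q) * ((h M + h (-M)) / 2)\<bar> \<le> H ^ (2*q) * \<bar>(h M + h (-M)) / 2\<bar>" if "y \<in> {-H..H}" for y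
        unfolding abs_mult by (intro mult_right_mono pw) (use that in auto)
    qed measurable
    show "set_integrable lborel {-H..H} (\<lambda>y. y ^ (2*q) * (chord_end_trunc M y - (h M + h (-M)) / 2))"
    proof (rule set_integrable_Icc_bounded[where B = "H ^ (2*q) * (h 0 + \<bar>(h M + h (-M)) / 2\<bar>)"])
      fix y assume "y \<in> {-H..H}"
      then have y: "\<bar>y\<bar> \<le> H" by auto
      have "\<bar>chord_end_trunc M y - (h M + h (-M)) / 2\<bar> \<le> h 0 + \<bar>(h M + h (-M)) / 2\<bar>"
        using abs_chord_end_trunc_le[OF assms y] by linarith
      then show "\<bar>y ^ (2*q) * (chord_end_trunc M y - (h M + h (-M)) / 2)\<bar> \<le> H ^ (2*q) * (h 0 + \<bar>(h M + h (-M)) / 2\<bar>)"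
        unfolding abs_mult by (intro mult_mono pw y) (use H_nonneg in auto)
    qed measurable
  qed
  have "(LBINT y:{-H..H}. y ^ (2*q) * chord_end_trunc M y)
     = (LBINT y:{-H..H}. y ^ (2*q) * ((h M + h (-M)) / 2) + y ^ (2*q) * (chord_end_trunc M y - (h M + h (-M)) / 2))"
    by (simp add: algebra_simps)
  also have "\<dots> = (LBINT y:{-H..H}. y ^ (2*q)) * ((h M + h (-M)) / 2)
       + (LBINT y:{-H..H}. y ^ (2*q) * (chord_end_trunc M y - (h M + h (-M)) / 2))"
    by (subst set_integral_add(2)[OF I1 I2]) (simp only: set_integral_mult_left)
  also have "(LBINT y:{-H..H}. y ^ (2*q) * (chord_end_trunc M y - (h M + h (-M)) / 2))
       = (LBINT y:{-H..H}. (- 1 / 2) * (y ^ (2*q) * (LBINT s:{-M..M}. \<bar>y - Y s\<bar>)))"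
    unfolding chord_end_trunc_def by (simp add: mult.commute)
  also have "\<dots> = (- 1 / 2) * (LBINT y:{-H..H}. y ^ (2*q) * (LBINT s:{-M..M}. \<bar>y - Y s\<bar>))"
    by (rule set_integral_mult_right)
  finally have "(LBINT y:{-H..H}. y ^ (2*q) * chord_end_trunc M y)
     = A * H ^ (2*q+1) * (h M + h (-M)) - 2 * M * A * H ^ (2*q+2)
       + B * (LBINT s:{-M..M}. H ^ (2*q+2) - Y s ^ (2*q+2))"
    unfolding fub mom by (simp add: algebra_simps)
  then show ?thesis by (simp add: A_def B_def diff_divide_distrib add_divide_distrib algebra_simps)
qed

text \<open>Horizontal slicing: the chord at height \<open>y\<close> has length
  \<open>chord_end y + chord_end (-y)\<close>.\<close>

lemma power_height_integral:
  "(LINT p|lborel. indicator L p * snd p ^ (2*q)) = (LBINT y:{-H..H}. y ^ (2*q) * (chord_end y + chord_end (-y)))"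
proof -
  have int: "integrable lborel (\<lambda>p. indicator L p * snd p ^ (2*q))"
    by (rule integral_compact_eq_LINT(1)[OF compact]) (intro continuous_intros)
  have "(LINT p|lborel. indicator L p * snd p ^ (2*q))
      = (LINT p|(lborel \<Otimes>\<^sub>M lborel). (\<lambda>(x, y). indicator L (x, y) * y ^ (2*q)) p)"
    by (simp add: lborel_prod case_prod_unfold)
  also have "\<dots> = (LBINT y. LBINT x. indicator L (x, y) * y ^ (2*q))"
    by (rule lborel_pair.integral_snd[symmetric])
      (use int in \<open>simp add: lborel_prod case_prod_unfold\<close>)
  also have "\<dots> = (LBINT y:{-H..H}. y ^ (2*q) * (chord_end y + chord_end (-y)))"
    unfolding set_lebesgue_integral_def
  proof (rule Bochner_Integration.integral_cong[OF refl])
    fix y :: real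
    show "(LBINT x. indicator L (x, y) * y ^ (2*q)) = indicator {-H..H} y *\<^sub>R (y ^ (2*q) * (chord_end y + chord_end (-y)))"
    proof (cases "\<bar>y\<bar> \<le> H")
      case True
      have "(LBINT x. indicator L (x, y) * y ^ (2*q)) = (LBINT x. indicator {- chord_end (-y)..chord_end y} x) * y ^ (2*q)"
        unfolding chord_eq[OF True, symmetric] by (simp add: indicator_def of_bool_def)
      \<comment> \<open>The chord contains \<open>chord_end y\<close>, so its left end does not
        exceed its right end and the difference is its length.\<close>
      also have "(LBINT x. indicator {- chord_end (-y)..chord_end y} x) = chord_end y + chord_end (-y)"
        using chord_end_mem[OF True] chord_eq[OF True] by auto
      finally show ?thesis using True by (simp add: indicator_def abs_le_iff algebra_simps)
    next
      case False
      then have "indicator L (x, y) = (0::real)" for x using abs_height_le[of "(x, y)"] by (auto simp: indicator_def)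
      moreover have "y \<notin> {-H..H}" using False by auto
      ultimately show ?thesis by simp
    qed
  qed
  finally show ?thesis .
qed

text \<open>Dominated convergence applied to both ends of the chord. Since \<open>y ^ (2*q)\<close>
  is even and the range of heights symmetric, the two ends contribute equally, whence the factor
  2.\<close>

lemma power_height_integral_LIMSEQ:
  "(\<lambda>n. 2 * (LBINT y:{-H..H}. y ^ (2*q) * chord_end_trunc (real n) y))
     \<longlonglongrightarrow> (LINT p|lborel. indicator L p * snd p ^ (2*q))"
proof -
  have pw: "\<bar>y ^ k\<bar> \<le> H ^ k" if "\<bar>y\<bar> \<le> H" for y k
    using that by (simp add: power_abs power_mono)
  have int: "set_integrable lborel {-H..H} (\<lambda>y. y ^ (2*q) * chord_end_trunc (real n) y)" for n
  proof (rule set_integrable_Icc_bounded)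
    fix y assume "y \<in> {-H..H}"
    then have y: "\<bar>y\<bar> \<le> H" by auto
    show "\<bar>y ^ (2*q) * chord_end_trunc (real n) y\<bar> \<le> H ^ (2*q) * h 0"
      unfolding abs_mult by (intro mult_mono pw y abs_chord_end_trunc_le) (use H_nonneg in auto)
  qed measurable
  have reflect: "(LBINT y:{-H..H}. y ^ (2*q) * chord_end_trunc (real n) (-y)) = (LBINT y:{-H..H}. y ^ (2*q) * chord_end_trunc (real n) y)"
    and int': "set_integrable lborel {-H..H} (\<lambda>y. y ^ (2*q) * chord_end_trunc (real n) (-y))" for n
  proof -
    have ind: "indicator {-H..H} (-y) = (indicator {-H..H} y :: real)" for y
      by (auto simp: indicator_def)
    show "(LBINT y:{-H..H}. y ^ (2*q) * chord_end_trunc (real n) (-y)) = (LBINT y:{-H..H}. y ^ (2*q) * chord_end_trunc (real n) y)"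
      unfolding set_lebesgue_integral_def
      by (subst (2) lborel_integral_real_affine[where c = "-1" and t = 0]) (simp_all add: ind)
    show "set_integrable lborel {-H..H} (\<lambda>y. y ^ (2*q) * chord_end_trunc (real n) (-y))"
      using lborel_integrable_real_affine[OF int[of n, unfolded set_integrable_def], of "-1" 0]
      unfolding set_integrable_def by (simp add: ind)
  qed
  have "(\<lambda>n. LBINT y. indicator {-H..H} y * (y ^ (2*q) * (chord_end_trunc (real n) y + chord_end_trunc (real n) (-y))))
     \<longlonglongrightarrow> (LBINT y. indicator {-H..H} y * (y ^ (2*q) * (chord_end y + chord_end (-y))))"
  proof (rule integral_dominated_convergence[where w = "\<lambda>y. indicator {-H..H} y * (H ^ (2*q) * (2 * h 0))"])
    have lim: "(\<lambda>n. indicator {-H..H} y * (y ^ (2*q) * (chord_end_trunc (real n) y + chord_end_trunc (real n) (-y))))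
        \<longlonglongrightarrow> indicator {-H..H} y * (y ^ (2*q) * (chord_end y + chord_end (-y)))" for y
    proof (cases "y \<in> {-H..H}")
      case True
      then show ?thesis by (intro tendsto_mult tendsto_add chord_end_trunc_LIMSEQ tendsto_const) auto
    qed simp
    then show "AE y in lborel. (\<lambda>n. indicator {-H..H} y * (y ^ (2*q) * (chord_end_trunc (real n) y + chord_end_trunc (real n) (-y))))
        \<longlonglongrightarrow> indicator {-H..H} y * (y ^ (2*q) * (chord_end y + chord_end (-y)))" by simp
    \<comment> \<open>Measurability of the limit is inherited from the truncations, whose
      measurability is known.\<close>
    show "(\<lambda>y. indicator {-H..H} y * (y ^ (2*q) * (chord_end y + chord_end (-y)))) \<in> borel_measurable lborel"
      by (rule borel_measurable_LIMSEQ_real[OF lim]) measurable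
    show "integrable lborel (\<lambda>y. indicator {-H..H} y * (H ^ (2*q) * (2 * h 0)))"
      using H_nonneg by simp
    show "AE y in lborel. norm (indicator {-H..H} y * (y ^ (2*q) * (chord_end_trunc (real n) y + chord_end_trunc (real n) (-y))))
       \<le> indicator {-H..H} y * (H ^ (2*q) * (2 * h 0))" for n
    proof (rule AE_I2)
      fix y :: real
      have "\<bar>y ^ (2*q)\<bar> * \<bar>chord_end_trunc (real n) y + chord_end_trunc (real n) (-y)\<bar> \<le> H ^ (2*q) * (2 * h 0)" if "\<bar>y\<bar> \<le> H"
        using abs_chord_end_trunc_le[of "real n" y] abs_chord_end_trunc_le[of "real n" "-y"] that
        by (intro mult_mono pw) (use H_nonneg in auto)
      then show "norm (indicator {-H..H} y * (y ^ (2*q) * (chord_end_trunc (real n) y + chord_end_trunc (real n) (-y))))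
       \<le> indicator {-H..H} y * (H ^ (2*q) * (2 * h 0))"
        by (auto simp: indicator_def abs_mult)
    qed
  qed measurable
  moreover have "(LBINT y. indicator {-H..H} y * (y ^ (2*q) * (chord_end_trunc (real n) y + chord_end_trunc (real n) (-y))))
     = 2 * (LBINT y:{-H..H}. y ^ (2*q) * chord_end_trunc (real n) y)" for n
    using set_integral_add(2)[OF int[of n] int'[of n]] reflect[of n]
    by (simp add: set_lebesgue_integral_def distrib_left)
  ultimately show ?thesis
    unfolding power_height_integral by (simp add: set_lebesgue_integral_def)
qed

end

subsection \<open>Minkowski combinations\<close>

lemma minkowski_comb_0: "minkowski_comb 0 lam K = {0}"
  by (auto simp: minkowski_comb_def)

lemma minkowski_comb_Suc:
  "minkowski_comb (Suc m) lam K = {x + y | x y. x \<in> minkowski_comb m lam K \<and> y \<in> (*\<^sub>R) (lam m) ` K m}"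
proof (intro subset_antisym subsetI)
  fix z assume "z \<in> minkowski_comb (Suc m) lam K"
  then obtain f where f: "\<forall>i<Suc m. f i \<in> K i" "z = (\<Sum>i<Suc m. lam i *\<^sub>R f i)"
    unfolding minkowski_comb_def by blast
  then have "(\<Sum>i<m. lam i *\<^sub>R f i) \<in> minkowski_comb m lam K" "lam m *\<^sub>R f m \<in> (*\<^sub>R) (lam m) ` K m"
    unfolding minkowski_comb_def by (auto intro!: exI[of _ f])
  then show "z \<in> {x + y | x y. x \<in> minkowski_comb m lam K \<and> y \<in> (*\<^sub>R) (lam m) ` K m}"
    using f(2) by auto
next
  fix z assume "z \<in> {x + y | x y. x \<in> minkowski_comb m lam K \<and> y \<in> (*\<^sub>R) (lam m) ` K m}"
  then obtain f y where f: "\<forall>i<m. f i \<in> K i" "y \<in> K m" "z = (\<Sum>i<m. lam i *\<^sub>R f i) + lam m *\<^sub>R y"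
    by (auto simp: minkowski_comb_def)
  then show "z \<in> minkowski_comb (Suc m) lam K"
    unfolding minkowski_comb_def by (auto intro!: exI[of _ "f(m := y)"] simp: less_Suc_eq)
qed

lemma compact_minkowski_comb:
  fixes K :: "nat \<Rightarrow> 'a::real_normed_vector set"
  assumes "\<And>i. i < m \<Longrightarrow> compact (K i)"
  shows "compact (minkowski_comb m lam K)"
  using assms
  by (induction m) (auto simp: minkowski_comb_0 minkowski_comb_Suc intro!: compact_sums compact_scaling)

lemma convex_minkowski_comb:
  assumes "\<And>i. i < m \<Longrightarrow> convex (K i)"
  shows "convex (minkowski_comb m lam K)"
proof (rule convexI)
  fix x y u v assume "x \<in> minkowski_comb m lam K" "y \<in> minkowski_comb m lam K" and uv: "0 \<le> u" "0 \<le> v" "u + v = (1::real)"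
  then obtain f g where f: "\<forall>i<m. f i \<in> K i" "x = (\<Sum>i<m. lam i *\<^sub>R f i)"
    and g: "\<forall>i<m. g i \<in> K i" "y = (\<Sum>i<m. lam i *\<^sub>R g i)"
    unfolding minkowski_comb_def by blast
  show "u *\<^sub>R x + v *\<^sub>R y \<in> minkowski_comb m lam K"
    unfolding minkowski_comb_def
  proof (intro CollectI exI[of _ "\<lambda>i. u *\<^sub>R f i + v *\<^sub>R g i"] conjI allI impI)
    show "u *\<^sub>R f i + v *\<^sub>R g i \<in> K i" if "i < m" for i
      using convexD[OF assms[OF that] _ _ uv] f(1) g(1) that by blast
    show "u *\<^sub>R x + v *\<^sub>R y = (\<Sum>i<m. lam i *\<^sub>R (u *\<^sub>R f i + v *\<^sub>R g i))"
      unfolding f(2) g(2) by (simp add: scaleR_sum_right sum.distrib[symmetric] algebra_simps)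
  qed
qed

lemma linear_image_minkowski_comb:
  assumes "linear T"
  shows "T ` minkowski_comb m lam K = minkowski_comb m lam (\<lambda>i. T ` K i)"
proof (intro subset_antisym subsetI)
  fix z assume "z \<in> T ` minkowski_comb m lam K"
  then obtain f where f: "\<forall>i<m. f i \<in> K i" "z = T (\<Sum>i<m. lam i *\<^sub>R f i)"
    unfolding minkowski_comb_def by blast
  then show "z \<in> minkowski_comb m lam (\<lambda>i. T ` K i)"
    unfolding minkowski_comb_def
    by (auto simp: linear_sum[OF assms] linear_cmul[OF assms] intro!: exI[of _ "\<lambda>i. T (f i)"])
next
  fix z assume "z \<in> minkowski_comb m lam (\<lambda>i. T ` K i)"
  then obtain g where g: "\<forall>i<m. g i \<in> T ` K i" "z = (\<Sum>i<m. lam i *\<^sub>R g i)"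
    unfolding minkowski_comb_def by blast
  then obtain f where f: "\<forall>i<m. f i \<in> K i \<and> g i = T (f i)"
    unfolding image_iff by metis
  have "z = T (\<Sum>i<m. lam i *\<^sub>R f i)"
    unfolding g(2) using f by (simp add: linear_sum[OF assms] linear_cmul[OF assms])
  then show "z \<in> T ` minkowski_comb m lam K"
    unfolding minkowski_comb_def using f by blast
qed

text \<open>Compactness provides a maximiser for each slope. The choice may be arbitrary, as the
  heights are automatically monotone in the slope and hence measurable.\<close>

lemma ex_planar_body:
  assumes "compact K" "convex K" "\<And>p. p \<in> K \<Longrightarrow> - p \<in> K" "K \<noteq> {}"
  shows "\<exists>h Y H. planar_body K h Y H"
proof -
  have "\<exists>p\<in>K. \<forall>p'\<in>K. fst p' - s * snd p' \<le> fst p - s * snd p" for s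
    using assms by (intro continuous_attains_sup continuous_intros) auto
  then obtain P where P: "\<And>s. P s \<in> K" "\<And>s p'. p' \<in> K \<Longrightarrow> fst p' - s * snd p' \<le> fst (P s) - s * snd (P s)"
    by metis
  have "\<exists>p\<in>K. \<forall>p'\<in>K. snd p' \<le> snd p"
    using assms by (intro continuous_attains_sup continuous_intros) auto
  then obtain Q where Q: "Q \<in> K" "\<And>p'. p' \<in> K \<Longrightarrow> snd p' \<le> snd Q" by metis
  have "planar_body K (\<lambda>s. fst (P s) - s * snd (P s)) (\<lambda>s. snd (P s)) (snd Q)"
  proof
    show "\<exists>x. (x, snd Q) \<in> K" using Q(1) by (metis prod.collapse)
  qed (use assms P Q in auto)
  then show ?thesis by blast
qed

text \<open>Support data add under Minkowski sums: for nonnegative weights, maximisers of the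
  summands combine to a maximiser of the sum. This makes \<open>h\<close>, \<open>Y\<close> and
  \<open>H\<close> linear in \<open>lam\<close>, with slope-dependent choices fixed once for each
  \<open>K i\<close>.\<close>

lemma planar_body_minkowski_comb:
  assumes body: "\<And>i. i < m \<Longrightarrow> planar_body (K i) (h i) (Y i) (H i)"
    and lam: "\<And>i. i < m \<Longrightarrow> 0 \<le> lam i"
  shows "planar_body (minkowski_comb m lam K)
    (\<lambda>s. \<Sum>i<m. lam i * h i s) (\<lambda>s. \<Sum>i<m. lam i * Y i s) (\<Sum>i<m. lam i * H i)"
proof
  let ?L = "minkowski_comb m lam K"
  show "compact ?L" by (rule compact_minkowski_comb) (rule planar_body.compact[OF body])
  show "convex ?L" by (rule convex_minkowski_comb) (rule planar_body.convex[OF body])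
  have memI: "p \<in> ?L" if "\<And>i. i < m \<Longrightarrow> f i \<in> K i" "fst p = (\<Sum>i<m. lam i * fst (f i))"
     "snd p = (\<Sum>i<m. lam i * snd (f i))" for p f
    unfolding minkowski_comb_def
    by (intro CollectI exI[of _ f]) (use that in \<open>auto simp: prod_eq_iff fst_sum snd_sum\<close>)
  have memE: "\<exists>f. (\<forall>i<m. f i \<in> K i) \<and> fst p = (\<Sum>i<m. lam i * fst (f i)) \<and> snd p = (\<Sum>i<m. lam i * snd (f i))"
    if "p \<in> ?L" for p
    using that unfolding minkowski_comb_def by (auto simp: fst_sum snd_sum)
  show "- p \<in> ?L" if p: "p \<in> ?L" for p
  proof -
    obtain f where f: "\<forall>i<m. f i \<in> K i" "fst p = (\<Sum>i<m. lam i * fst (f i))" "snd p = (\<Sum>i<m. lam i * snd (f i))"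
      using memE[OF p] by blast
    show ?thesis
      by (rule memI[of "\<lambda>i. - f i"]) (use f in \<open>auto simp: sum_negf intro: planar_body.symmetric[OF body]\<close>)
  qed
  show "fst p - s * snd p \<le> (\<Sum>i<m. lam i * h i s)" if p: "p \<in> ?L" for p s
  proof -
    obtain f where f: "\<forall>i<m. f i \<in> K i" "fst p = (\<Sum>i<m. lam i * fst (f i))" "snd p = (\<Sum>i<m. lam i * snd (f i))"
      using memE[OF p] by blast
    have "fst p - s * snd p = (\<Sum>i<m. lam i * (fst (f i) - s * snd (f i)))"
      unfolding f by (simp add: sum_distrib_left sum_subtractf right_diff_distrib mult.left_commute)
    also have "\<dots> \<le> (\<Sum>i<m. lam i * h i s)"
      by (intro sum_mono mult_left_mono) (use f lam in \<open>auto intro: planar_body.support_le[OF body]\<close>)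
    finally show ?thesis .
  qed
  show "snd p \<le> (\<Sum>i<m. lam i * H i)" if p: "p \<in> ?L" for p
  proof -
    obtain f where f: "\<forall>i<m. f i \<in> K i" "snd p = (\<Sum>i<m. lam i * snd (f i))"
      using memE[OF p] by blast
    show ?thesis unfolding f(2)
      by (intro sum_mono mult_left_mono) (use f lam in \<open>auto intro: planar_body.height_le[OF body]\<close>)
  qed
  show "((\<Sum>i<m. lam i * h i s) + s * (\<Sum>i<m. lam i * Y i s), \<Sum>i<m. lam i * Y i s) \<in> ?L" for s
    by (rule memI[of "\<lambda>i. (h i s + s * Y i s, Y i s)"])
      (auto simp: planar_body.support_point[OF body] sum_distrib_left distrib_left sum.distrib mult.left_commute)
  have "\<exists>x. \<forall>i<m. (x i, H i) \<in> K i"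
    using planar_body.height_point[OF body] by metis
  then obtain x where "\<And>i. i < m \<Longrightarrow> (x i, H i) \<in> K i" by blast
  then have "(\<Sum>i<m. lam i * x i, \<Sum>i<m. lam i * H i) \<in> ?L"
    by (intro memI[of "\<lambda>i. (x i, H i)"]) auto
  then show "\<exists>x. (x, \<Sum>i<m. lam i * H i) \<in> ?L" by blast
qed

text \<open>Each truncated moment is a form with nonnegative coefficients by the explicit formula,
  and the limit in the truncation keeps this property.\<close>

proposition homogeneous_nonneg_power_height:
  fixes K :: "nat \<Rightarrow> (real \<times> real) set"
  assumes "\<And>i. i < m \<Longrightarrow> compact (K i)" "\<And>i. i < m \<Longrightarrow> convex (K i)"
    and "\<And>i p. i < m \<Longrightarrow> p \<in> K i \<Longrightarrow> - p \<in> K i" and "\<And>i. i < m \<Longrightarrow> K i \<noteq> {}"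
  shows "homogeneous_nonneg m (2*q+2)
    (\<lambda>lam. LINT p|lborel. indicator (minkowski_comb m lam K) p * snd p ^ (2*q))"
proof -
  have "\<forall>i. \<exists>h Y H. i < m \<longrightarrow> planar_body (K i) h Y H" using ex_planar_body assms by metis
  then obtain h Y H where body: "\<And>i. i < m \<Longrightarrow> planar_body (K i) (h i) (Y i) (H i)"
    by metis
  define w where "w M i = h i M + h i (-M) - 2 * M * H i" for M i
  \<comment> \<open>Twice the truncated moment formula with \<open>real n\<close> for
    \<open>M\<close>. The factors with index at most \<open>2*q\<close> give the power of the
    height, and the factor with index \<open>2*q+1\<close> gives the width defect.\<close>
  define F where "F n lam = 2 * ((\<Prod>k<2*q+2. \<Sum>i<m. lam i * (if k < 2*q+1 then H i else w (real n) i)) / (2 * real q + 1)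
     + (LBINT s:{- real n..real n}. (\<Sum>i<m. lam i * H i) ^ (2*q+2) - (\<Sum>i<m. lam i * Y i s) ^ (2*q+2))
        / ((2 * real q + 1) * (2 * real q + 2)))" for n lam
  show ?thesis
  proof (rule homogeneous_nonneg_LIMSEQ)
    fix n
    have 1: "homogeneous_nonneg m (2*q+2) (\<lambda>lam. \<Prod>k<2*q+2. \<Sum>i<m. lam i * (if k < 2*q+1 then H i else w (real n) i))"
      by (rule homogeneous_nonneg_prod_linear)
        (use planar_body.H_nonneg[OF body] planar_body.support_sum_ge[OF body] in \<open>auto simp: w_def\<close>)
    have 2: "homogeneous_nonneg m (2*q+2) (\<lambda>lam. LBINT s:{- real n..real n}.
        (\<Sum>i<m. lam i * H i) ^ (2*q+2) - (\<Sum>i<m. lam i * Y i s) ^ (2*q+2))"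
      by (rule homogeneous_nonneg_integral_power_diff)
        (auto intro: planar_body.Y_measurable[OF body] planar_body.abs_Y_le[OF body])
    have "homogeneous_nonneg m (2*q+2) (\<lambda>lam. 2 * (1 / (2 * real q + 1) *
        (\<Prod>k<2*q+2. \<Sum>i<m. lam i * (if k < 2*q+1 then H i else w (real n) i))
        + 1 / ((2 * real q + 1) * (2 * real q + 2)) * (LBINT s:{- real n..real n}.
        (\<Sum>i<m. lam i * H i) ^ (2*q+2) - (\<Sum>i<m. lam i * Y i s) ^ (2*q+2))))"
      by (intro homogeneous_nonneg_cmult homogeneous_nonneg_add 1 2) auto
    then show "homogeneous_nonneg m (2*q+2) (F n)"
      by (simp add: F_def[abs_def])
  next
    fix lam :: "nat \<Rightarrow> real" assume lam: "\<And>i. i < m \<Longrightarrow> 0 \<le> lam i"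
    interpret L: planar_body "minkowski_comb m lam K" "\<lambda>s. \<Sum>i<m. lam i * h i s"
      "\<lambda>s. \<Sum>i<m. lam i * Y i s" "\<Sum>i<m. lam i * H i"
      by (rule planar_body_minkowski_comb[OF body lam])
    have w: "(\<Sum>i<m. lam i * w M i) = (\<Sum>i<m. lam i * h i M) + (\<Sum>i<m. lam i * h i (-M)) - 2 * M * (\<Sum>i<m. lam i * H i)" for M
      by (simp add: w_def sum_distrib_left algebra_simps sum.distrib sum_subtractf)
    have "F n lam = 2 * (LBINT y:{- (\<Sum>i<m. lam i * H i)..(\<Sum>i<m. lam i * H i)}. y ^ (2*q) * L.chord_end_trunc (real n) y)" for n
    proof -
      have "(\<Prod>k<2*q+2. \<Sum>i<m. lam i * (if k < 2*q+1 then H i else w (real n) i))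
        = (\<Prod>k<2*q+1. \<Sum>i<m. lam i * (if k < 2*q+1 then H i else w (real n) i)) * (\<Sum>i<m. lam i * w (real n) i)"
        by simp
      also have "(\<Prod>k<2*q+1. \<Sum>i<m. lam i * (if k < 2*q+1 then H i else w (real n) i)) = (\<Prod>k<2*q+1. \<Sum>i<m. lam i * H i)"
        by (intro prod.cong) auto
      finally show ?thesis
        unfolding F_def L.power_chord_end_trunc_integral[OF of_nat_0_le_iff] w by simp
    qed
    then show "(\<lambda>n. F n lam) \<longlonglongrightarrow> (LINT p|lborel. indicator (minkowski_comb m lam K) p * snd p ^ (2*q))"
      using L.power_height_integral_LIMSEQ[of q] by simp
  qed
qed

subsection \<open>Reduction to powers of one coordinate\<close>

text \<open>A geometric sum over the powers of a root of unity of order dividing q + 1, which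
  differs from 1 because \<open>q - j\<close> is nonzero and smaller than q + 1 in absolute
  value.\<close>

lemma sum_cis_multiples_eq_0:
  fixes q j :: nat
  assumes "j \<le> 2 * q" "j \<noteq> q"
  shows "(\<Sum>k<Suc q. cis (real k * (2 * pi * (real q - real j) / real (Suc q)))) = 0"
proof -
  define t where "t = 2 * pi * (real q - real j) / real (Suc q)"
  have "cis t \<noteq> 1"
  proof
    assume "cis t = 1"
    then have "cos t = 1" by (simp add: complex_eq_iff)
    then obtain n :: int where n: "t = real_of_int n * 2 * pi" using cos_one_2pi_int by blast
    then have "2 * pi * (real q - real j) = 2 * pi * (real_of_int n * real (Suc q))"
      unfolding t_def by (simp add: divide_eq_eq ac_simps del: of_nat_Suc)
    then have "real q - real j = real_of_int n * real (Suc q)"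
      by (subst (asm) mult_left_cancel) auto
    then have eq: "int q - int j = n * int (Suc q)"
      by (metis (mono_tags) of_int_diff of_int_eq_iff of_int_mult of_int_of_nat_eq)
    have "\<bar>int q - int j\<bar> < int (Suc q)" using assms(1) by auto
    then have "\<bar>n\<bar> * int (Suc q) < 1 * int (Suc q)" unfolding eq abs_mult by simp
    then have "n = 0" by (subst (asm) mult_less_cancel_right_pos) auto
    then show False using eq assms(2) by simp
  qed
  moreover have "cis t ^ Suc q = 1"
  proof -
    have "real (Suc q) * t = 2 * pi * real_of_int (int q - int j)"
      unfolding t_def by (simp del: of_nat_Suc)
    then show ?thesis unfolding Complex.DeMoivre by (simp only: cis_multiple_2pi Ints_of_int)
  qed
  ultimately have "(\<Sum>k<Suc q. cis t ^ k) = 0"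
    by (subst geometric_sum) auto
  then show ?thesis unfolding t_def[symmetric] Complex.DeMoivre .
qed

text \<open>With z = x + iy, the component in direction \<open>a k\<close> is half the sum of
  \<open>z * cis (- a k)\<close> and its conjugate. In the binomial expansion of its power, summing
  over the directions removes every term except the middle one, \<open>j = q\<close>.\<close>

lemma sum_power_rotated_coordinate:
  fixes x y :: real
  shows "(\<Sum>k<Suc q. (x * cos (real k * pi / real (Suc q)) + y * sin (real k * pi / real (Suc q))) ^ (2*q))
    = real (Suc q) * real ((2*q) choose q) / 4 ^ q * (x\<^sup>2 + y\<^sup>2) ^ q"
proof -
  define z where "z = Complex x y"
  define a where "a k = real k * pi / real (Suc q)" for k
  have zz: "z * cnj z = of_real (x\<^sup>2 + y\<^sup>2)" by (simp add: z_def complex_mult_cnj)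
  have base: "of_real (x * cos (a k) + y * sin (a k)) = (z * cis (- a k) + cnj z * cis (a k)) / 2" for k
    by (simp add: z_def complex_eq_iff)
  have pw: "of_real ((x * cos (a k) + y * sin (a k)) ^ (2*q))
     = (\<Sum>j\<le>2*q. of_nat ((2*q) choose j) * z ^ j * cnj z ^ (2*q - j) / 4 ^ q
          * cis (real k * (2 * pi * (real q - real j) / real (Suc q))))" for k
  proof -
    have "of_real ((x * cos (a k) + y * sin (a k)) ^ (2*q)) = (z * cis (- a k) + cnj z * cis (a k)) ^ (2*q) / 4 ^ q"
      unfolding of_real_power base by (simp add: power_divide power_mult)
    also have "(z * cis (- a k) + cnj z * cis (a k)) ^ (2*q)
       = (\<Sum>j\<le>2*q. of_nat ((2*q) choose j) * (z * cis (- a k)) ^ j * (cnj z * cis (a k)) ^ (2*q - j))"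
      by (rule binomial_ring)
    also have "\<dots> = (\<Sum>j\<le>2*q. of_nat ((2*q) choose j) * z ^ j * cnj z ^ (2*q - j)
          * cis (real k * (2 * pi * (real q - real j) / real (Suc q))))"
    proof (rule sum.cong[OF refl])
      fix j assume "j \<in> {..2*q}"
      \<comment> \<open>The phase is \<open>2 * (q - j) * a k\<close>; the doubling is why
        directions over a half circle suffice.\<close>
      then have "real j * - a k + real (2*q - j) * a k = real k * (2 * pi * (real q - real j) / real (Suc q))"
        unfolding a_def by (simp add: of_nat_diff field_simps del: of_nat_Suc)
      then have "cis (- a k) ^ j * cis (a k) ^ (2*q - j) = cis (real k * (2 * pi * (real q - real j) / real (Suc q)))"
        by (simp only: Complex.DeMoivre cis_mult)
      then show "of_nat ((2*q) choose j) * (z * cis (- a k)) ^ j * (cnj z * cis (a k)) ^ (2*q - j)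
        = of_nat ((2*q) choose j) * z ^ j * cnj z ^ (2*q - j) * cis (real k * (2 * pi * (real q - real j) / real (Suc q)))"
        by (simp add: power_mult_distrib ac_simps del: of_nat_Suc)
    qed
    finally show ?thesis by (simp add: sum_divide_distrib)
  qed
  have "complex_of_real (\<Sum>k<Suc q. (x * cos (a k) + y * sin (a k)) ^ (2*q))
     = (\<Sum>k<Suc q. of_real ((x * cos (a k) + y * sin (a k)) ^ (2*q)))"
    by (rule of_real_sum)
  also have "\<dots> = (\<Sum>j\<le>2*q. of_nat ((2*q) choose j) * z ^ j * cnj z ^ (2*q - j) / 4 ^ q
      * (\<Sum>k<Suc q. cis (real k * (2 * pi * (real q - real j) / real (Suc q)))))"
    unfolding pw sum_distrib_left by (rule sum.swap)
  also have "\<dots> = (\<Sum>j\<in>{q}. of_nat ((2*q) choose j) * z ^ j * cnj z ^ (2*q - j) / 4 ^ q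
      * (\<Sum>k<Suc q. cis (real k * (2 * pi * (real q - real j) / real (Suc q)))))"
  proof (rule sum.mono_neutral_right)
    show "\<forall>j\<in>{..2*q} - {q}. of_nat ((2*q) choose j) * z ^ j * cnj z ^ (2*q - j) / 4 ^ q
      * (\<Sum>k<Suc q. cis (real k * (2 * pi * (real q - real j) / real (Suc q)))) = 0"
    proof
      fix j assume "j \<in> {..2*q} - {q}"
      then have "j \<le> 2 * q" "j \<noteq> q" by auto
      from sum_cis_multiples_eq_0[OF this]
      show "of_nat ((2*q) choose j) * z ^ j * cnj z ^ (2*q - j) / 4 ^ q
        * (\<Sum>k<Suc q. cis (real k * (2 * pi * (real q - real j) / real (Suc q)))) = 0"
        by (simp only: mult_zero_right)
    qed
  qed auto
  also have "\<dots> = of_nat ((2*q) choose q) * (z ^ q * cnj z ^ q) / 4 ^ q * of_nat (Suc q)"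
  proof -
    have "2 * q - q = q" by simp
    then show ?thesis by (simp add: mult.assoc)
  qed
  also have "z ^ q * cnj z ^ q = of_real ((x\<^sup>2 + y\<^sup>2) ^ q)"
    by (simp only: power_mult_distrib[symmetric] zz of_real_power)
  also have "of_nat ((2*q) choose q) * of_real ((x\<^sup>2 + y\<^sup>2) ^ q) / 4 ^ q * of_nat (Suc q)
     = complex_of_real (real (Suc q) * real ((2*q) choose q) / 4 ^ q * (x\<^sup>2 + y\<^sup>2) ^ q)"
    by (simp del: of_nat_Suc)
  finally show ?thesis unfolding a_def of_real_eq_iff .
qed

text \<open>The second coordinate is the component along (cos t, sin t), so powers of it become
  powers of the height. The map has determinant -1, which is harmless for Lebesgue measure, and it
  lands in a product space, where Fubini applies.\<close>

definition rotated_coordinates :: "real \<Rightarrow> real^2 \<Rightarrow> real \<times> real" where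
  "rotated_coordinates t s = (s$2 * cos t - s$1 * sin t, s$1 * cos t + s$2 * sin t)"

lemma linear_rotated_coordinates: "linear (rotated_coordinates t)"
  by (rule linearI) (auto simp: rotated_coordinates_def algebra_simps)

lemma continuous_rotated_coordinates: "continuous_on S (rotated_coordinates t)"
  unfolding rotated_coordinates_def by (intro continuous_intros)

lemma rotated_coordinates_inverse:
  "s$1 = snd (rotated_coordinates t s) * cos t - fst (rotated_coordinates t s) * sin t"
  "s$2 = snd (rotated_coordinates t s) * sin t + fst (rotated_coordinates t s) * cos t"
proof -
  have "s$1 = s$1 * ((cos t)\<^sup>2 + (sin t)\<^sup>2)" "s$2 = s$2 * ((cos t)\<^sup>2 + (sin t)\<^sup>2)" by simp_all
  then show "s$1 = snd (rotated_coordinates t s) * cos t - fst (rotated_coordinates t s) * sin t"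
     "s$2 = snd (rotated_coordinates t s) * sin t + fst (rotated_coordinates t s) * cos t"
    unfolding rotated_coordinates_def fst_conv snd_conv power2_eq_square by (simp_all only: algebra_simps)
qed

lemma inj_rotated_coordinates: "inj (rotated_coordinates t)"
proof (rule injI)
  fix s s' assume "rotated_coordinates t s = rotated_coordinates t s'"
  then have "s$1 = s'$1" "s$2 = s'$2"
    using rotated_coordinates_inverse[of s t] rotated_coordinates_inverse[of s' t] by simp_all
  then show "s = s'" by (simp add: vec_eq_iff forall_2)
qed

text \<open>It suffices to compare boxes. The preimage of a box is, after identifying pairs with
  vectors, the image of a box under an orthogonal map, which preserves volume.\<close>

lemma distr_rotated_coordinates: "distr lborel borel (rotated_coordinates t) = lborel"
proof (rule lborel_eqI[symmetric])
  have meas [measurable]: "rotated_coordinates t \<in> borel_measurable borel"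
    by (rule borel_measurable_continuous_onI[OF continuous_rotated_coordinates])
  fix l u :: "real \<times> real" assume le: "\<And>b. b \<in> Basis \<Longrightarrow> l \<bullet> b \<le> u \<bullet> b"
  have le': "fst l \<le> fst u" "snd l \<le> snd u"
    using le[of "(1, 0)"] le[of "(0, 1)"] by (auto simp: Basis_prod_def inner_prod_def)
  \<comment> \<open>The inverse of \<open>rotated_coordinates t\<close>, read on vectors instead of
    pairs so that it is an endomorphism.\<close>
  define R :: "real^2 \<Rightarrow> real^2" where "R p = vector [p$2 * cos t - p$1 * sin t, p$2 * sin t + p$1 * cos t]" for p
  have R: "orthogonal_transformation R"
    unfolding orthogonal_transformation_def
  proof (intro conjI allI)
    show "linear R" by (rule linearI) (auto simp: R_def vec_eq_iff forall_2 algebra_simps)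
    fix v w :: "real^2"
    have "R v \<bullet> R w = (v$1 * w$1 + v$2 * w$2) * ((cos t)\<^sup>2 + (sin t)\<^sup>2)"
      unfolding power2_eq_square by (simp add: R_def inner_vec_def sum_2 algebra_simps del: sin_cos_squared_add3)
    then show "R v \<bullet> R w = v \<bullet> w" by (simp add: inner_vec_def sum_2)
  qed
  define B :: "(real^2) set" where "B = box (vector [fst l, snd l]) (vector [fst u, snd u])"
  have "rotated_coordinates t -` box l u = R ` B"
  proof (intro subset_antisym subsetI)
    fix s assume "s \<in> rotated_coordinates t -` box l u"
    then have "vector [fst (rotated_coordinates t s), snd (rotated_coordinates t s)] \<in> B"
      unfolding B_def by (auto simp: mem_box_cart forall_2 mem_box Basis_prod_def inner_prod_def)
    moreover have "s = R (vector [fst (rotated_coordinates t s), snd (rotated_coordinates t s)])"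
      using rotated_coordinates_inverse[of s t] by (simp add: R_def vec_eq_iff forall_2)
    ultimately show "s \<in> R ` B" by blast
  next
    fix s assume "s \<in> R ` B"
    then obtain p where p: "p \<in> B" "s = R p" by blast
    have "rotated_coordinates t s = (p$1 * ((cos t)\<^sup>2 + (sin t)\<^sup>2), p$2 * ((cos t)\<^sup>2 + (sin t)\<^sup>2))"
      unfolding p(2) power2_eq_square by (simp add: R_def rotated_coordinates_def algebra_simps del: sin_cos_squared_add3)
    then have "rotated_coordinates t s = (p$1, p$2)" by simp
    then show "s \<in> rotated_coordinates t -` box l u"
      using p(1) unfolding B_def by (auto simp: mem_box_cart forall_2 mem_box Basis_prod_def inner_prod_def)
  qed
  then have "emeasure (distr lborel borel (rotated_coordinates t)) (box l u) = emeasure lborel (R ` B)"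
    by (simp add: emeasure_distr)
  also have "\<dots> = emeasure lebesgue (R ` B)"
  proof -
    have "R ` B \<in> sets borel"
      using measurable_sets[OF meas, of "box l u"] \<open>rotated_coordinates t -` box l u = R ` B\<close> by simp
    then show ?thesis by simp
  qed
  also have "\<dots> = measure lebesgue (R ` B)"
    by (rule emeasure_eq_measure2, rule measurable_orthogonal_image[OF R]) (simp add: B_def)
  also have "measure lebesgue (R ` B) = measure lebesgue B"
    by (rule measure_orthogonal_image[OF R]) (simp add: B_def)
  also have "\<dots> = (fst u - fst l) * (snd u - snd l)"
  proof -
    let ?l = "vector [fst l, snd l] :: real^2" and ?u = "vector [fst u, snd u] :: real^2"
    have "cbox ?l ?u \<noteq> {}" using le' by (simp add: interval_ne_empty_cart forall_2)
    then have "measure lborel (cbox ?l ?u) = (fst u - fst l) * (snd u - snd l)"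
      by (simp add: content_cbox_cart prod_2 UNIV_2)
    then show ?thesis unfolding B_def by (simp add: measure_lborel_box_eq measure_lborel_cbox_eq)
  qed
  also have "\<dots> = (\<Prod>b\<in>Basis. (u - l) \<bullet> b)"
  proof -
    have basis: "Basis = {(1::real, 0::real), (0, 1)}" by (auto simp: Basis_prod_def)
    show ?thesis unfolding basis by (simp add: inner_prod_def)
  qed
  finally show "emeasure (distr lborel borel (rotated_coordinates t)) (box l u) = (\<Prod>b\<in>Basis. (u - l) \<bullet> b)" .
qed simp

lemma LINT_rotated_coordinates:
  assumes "compact L"
  shows "(LINT s|lborel. indicator L s * snd (rotated_coordinates t s) ^ n)
    = (LINT p|lborel. indicator (rotated_coordinates t ` L) p * snd p ^ n)"
proof -
  have meas: "rotated_coordinates t \<in> lborel \<rightarrow>\<^sub>M borel"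
    using borel_measurable_continuous_onI[OF continuous_rotated_coordinates] by simp
  have "compact (rotated_coordinates t ` L)"
    by (rule compact_continuous_image[OF continuous_rotated_coordinates assms])
  then have [measurable]: "rotated_coordinates t ` L \<in> sets borel" by (rule borel_compact)
  have "(LINT p|lborel. indicator (rotated_coordinates t ` L) p * snd p ^ n)
     = (LINT p|distr lborel borel (rotated_coordinates t). indicator (rotated_coordinates t ` L) p * snd p ^ n)"
    unfolding distr_rotated_coordinates ..
  also have "\<dots> = (LINT s|lborel. indicator (rotated_coordinates t ` L) (rotated_coordinates t s)
      * snd (rotated_coordinates t s) ^ n)"
    by (rule integral_distr[OF meas], intro borel_measurable_times borel_measurable_indicator
        borel_measurable_continuous_onI continuous_intros) measurable
  also have "\<dots> = (LINT s|lborel. indicator L s * snd (rotated_coordinates t s) ^ n)"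
    by (simp add: indicator_def inj_image_mem_iff[OF inj_rotated_coordinates])
  finally show ?thesis by simp
qed

section \<open>The integral of the norm power as a sum over directions\<close>

theorem theorem6p2:
  fixes m q :: nat and K :: "nat \<Rightarrow> (real^2) set"
  assumes "\<And>i. i < m \<Longrightarrow> compact (K i)"
      and "\<And>i. i < m \<Longrightarrow> convex (K i)"
      and "\<And>i. i < m \<Longrightarrow> uminus ` (K i) = K i"
  shows "\<exists>c :: (nat \<Rightarrow> nat) \<Rightarrow> real.
           finite {\<alpha>. c \<alpha> \<noteq> 0} \<and> (\<forall>\<alpha>. c \<alpha> \<ge> 0) \<and>
           (\<forall>lam :: nat \<Rightarrow> real. (\<forall>i<m. lam i \<ge> 0) \<longrightarrow>
              integral (minkowski_comb m lam K) (\<lambda>s. norm s ^ (2*q))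
                = (\<Sum>\<alpha>\<in>{\<alpha>. c \<alpha> \<noteq> 0}. c \<alpha> * (\<Prod>i<m. lam i ^ \<alpha> i)))"
\<comment> \<open>An empty \<open>K i\<close> makes the combination empty for every
  \<open>lam\<close>, even when \<open>lam i = 0\<close>, so the zero polynomial serves. Otherwise
  support points exist.\<close>
proof (cases "\<exists>i<m. K i = {}")
  case True
  then have "minkowski_comb m lam K = {}" for lam
    unfolding minkowski_comb_def by blast
  then show ?thesis by (intro exI[of _ "\<lambda>_. 0"]) simp
next
  case False
  define a where "a k = real k * pi / real (Suc q)" for k
  define A where "A = real (Suc q) * real ((2*q) choose q) / 4 ^ q"
  have "0 < A" unfolding A_def by (simp del: of_nat_Suc)
  have norm_eq: "norm s ^ (2*q) = 1 / A * (\<Sum>k<Suc q. snd (rotated_coordinates (a k) s) ^ (2*q))" for s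
  proof -
    have "norm s ^ (2*q) = ((s$1)\<^sup>2 + (s$2)\<^sup>2) ^ q"
      unfolding power_mult by (simp add: norm_vec_def L2_set_def sum_2)
    then show ?thesis
      using sum_power_rotated_coordinate[where x = "s$1" and y = "s$2" and q = q] \<open>0 < A\<close>
      unfolding rotated_coordinates_def a_def[symmetric] A_def[symmetric] by (simp add: field_simps)
  qed
  have "homogeneous_nonneg m (2*q+2) (\<lambda>lam. LINT p|lborel.
      indicator (minkowski_comb m lam (\<lambda>i. rotated_coordinates t ` K i)) p * snd p ^ (2*q))" for t
  proof (rule homogeneous_nonneg_power_height)
    fix i assume i: "i < m"
    show "compact (rotated_coordinates t ` K i)"
      by (rule compact_continuous_image[OF continuous_rotated_coordinates assms(1)[OF i]])
    show "convex (rotated_coordinates t ` K i)"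
      by (rule convex_linear_image[OF linear_rotated_coordinates assms(2)[OF i]])
    show "rotated_coordinates t ` K i \<noteq> {}" using False i by blast
    show "- p \<in> rotated_coordinates t ` K i" if p: "p \<in> rotated_coordinates t ` K i" for p
    proof -
      obtain s where s: "s \<in> K i" "p = rotated_coordinates t s" using p by blast
      then have "- s \<in> K i" using assms(3)[OF i] by blast
      then show ?thesis
        unfolding s(2) linear_neg[OF linear_rotated_coordinates, symmetric] by (rule imageI)
    qed
  qed
  then have "homogeneous_nonneg m (2*q+2) (\<lambda>lam. 1 / A * (\<Sum>k<Suc q. LINT p|lborel.
      indicator (minkowski_comb m lam (\<lambda>i. rotated_coordinates (a k) ` K i)) p * snd p ^ (2*q)))"
    using \<open>0 < A\<close> by (intro homogeneous_nonneg_cmult homogeneous_nonneg_sum) auto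
  then have "homogeneous_nonneg m (2*q+2) (\<lambda>lam. integral (minkowski_comb m lam K) (\<lambda>s. norm s ^ (2*q)))"
  proof (rule homogeneous_nonneg_cong)
    fix lam :: "nat \<Rightarrow> real"
    let ?L = "minkowski_comb m lam K"
    have L: "compact ?L" by (rule compact_minkowski_comb) (rule assms(1))
    have "integral ?L (\<lambda>s. norm s ^ (2*q)) = (LINT s|lborel. indicator ?L s * norm s ^ (2*q))"
      by (rule integral_compact_eq_LINT(2)[OF L]) (intro continuous_intros)
    also have "\<dots> = (LINT s|lborel. 1 / A * (\<Sum>k<Suc q. indicator ?L s * snd (rotated_coordinates (a k) s) ^ (2*q)))"
      unfolding norm_eq sum_distrib_left[symmetric] by (simp only: mult.left_commute)
    also have "\<dots> = 1 / A * (LINT s|lborel. (\<Sum>k<Suc q. indicator ?L s * snd (rotated_coordinates (a k) s) ^ (2*q)))"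
      by (rule integral_mult_right_zero)
    also have "(LINT s|lborel. (\<Sum>k<Suc q. indicator ?L s * snd (rotated_coordinates (a k) s) ^ (2*q)))
       = (\<Sum>k<Suc q. LINT s|lborel. indicator ?L s * snd (rotated_coordinates (a k) s) ^ (2*q))"
      by (intro Bochner_Integration.integral_sum integral_compact_eq_LINT(1)[OF L]
          continuous_intros continuous_rotated_coordinates)
    \<comment> \<open>Linear maps commute with Minkowski combinations, so the rotated body is the
      same combination of the rotated \<open>K i\<close>, whose moments are already known to be
      polynomial.\<close>
    finally show "integral ?L (\<lambda>s. norm s ^ (2*q)) = 1 / A * (\<Sum>k<Suc q. LINT p|lborel.
      indicator (minkowski_comb m lam (\<lambda>i. rotated_coordinates (a k) ` K i)) p * snd p ^ (2*q))"
      unfolding LINT_rotated_coordinates[OF L] linear_image_minkowski_comb[OF linear_rotated_coordinates] .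
  qed
  then show ?thesis by (rule homogeneous_nonneg_exponents)
qed

end
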